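(* Let $A$ be a finite group of odd order and $V$ a finite $\mathbf F_2$-vector space on which $A$ acts $\mathbf F_2$-linearly with $C_V(A)=0$. If $(A,V)$ is balanced and $V'$ is any finite $\mathbf F_2[A]$-module with $C_{V'}(A)=0$, then $(A,V\oplus V')$ is balanced. Consequently, for each finite group $A$ of odd order admitting one balanced module (a finite $\mathbf F_2$-vector space $V$ on which $A$ acts $\mathbf F_2$-linearly with $C_V(A)=0$ and with $(A,V)$ balanced), there are balanced pairs $(A,V)$ with $\dim V$ arbitrarily large, and hence infinitely many groups $G=B\rtimes V$, $B=\{f:V\to\mathbf F_2\}$, for which $C=C_G(A)$ is elementary abelian, $|\operatorname{Irr}_A(G)|=|C/C'|$ and $|N_A(G)|<|C/C'|$.
   Context: For $A$ of odd order acting $\mathbf F_2$-linearly on a finite $\mathbf F_2$-space $V$ with $C_V(A)=0$ (no nonzero vector fixed by all of $A$), the pair $(A,V)$ is called balanced if $V$ has an $A$-stable subset of size $|V|/2$. $B$ is the additive group of all functions $V\to\mathbf F_2$; $(\tau_tf)(x)=f(x+t)$; $G=B\rtimes V$ has multiplication $(f,t)(g,s)=(f+\tau_tg,\,t+s)$; $A$ acts on $G$ by $a\cdot(f,t)=(f\circ a^{-1},a\cdot t)$. $C_G(A)$ is the subgroup of $A$-fixed elements, $\operatorname{Irr}_A(G)$ the set of $A$-invariant irreducible complex characters of $G$, and $N_A(G)=\{\chi\in\operatorname{Irr}_A(G):\chi(c)\ne0\ \forall c\in C_G(A)\}$. *)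

theory Defs
  imports
    "HOL-Library.Z2"
    "HOL-Algebra.Group_Action"
    "HOL-Algebra.Generated_Groups"
    "HOL-Computational_Algebra.Primes"
    "Jordan_Normal_Form.VS_Connect"
begin

section \<open>Modules over the field with two elements\<close>

abbreviation F2 :: "bit ring" where
  "F2 \<equiv> class_ring"

text \<open>Vector spaces, sums and dimensions are the carrier-based ones of the theory
  \<open>VectorSpace\<close>, actions are those of \<open>HOL-Algebra\<close>.  As usual there, every \<open>\<phi> a\<close> is
  undefined outside the carrier.\<close>

locale finite_F2_module =
  fixes A :: "('a, 'm) monoid_scheme" and V :: "(bit, 'v) module" and \<phi> :: "'a \<Rightarrow> 'v \<Rightarrow> 'v"
  assumes vectorspace: "vectorspace F2 V"
    and finite_carrier: "finite (carrier V)"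
    and action: "group_action A (carrier V) \<phi>"
    and linear: "a \<in> carrier A \<Longrightarrow> linear_map F2 V V (\<phi> a)"

definition fixed_points :: "('a, 'm) monoid_scheme \<Rightarrow> ('a \<Rightarrow> 'x \<Rightarrow> 'x) \<Rightarrow> 'x set \<Rightarrow> 'x set" where
  "fixed_points A \<phi> E = {x \<in> E. \<forall>a \<in> carrier A. \<phi> a x = x}"

definition no_fixed_vector ::
  "('a, 'm) monoid_scheme \<Rightarrow> (bit, 'v) module \<Rightarrow> ('a \<Rightarrow> 'v \<Rightarrow> 'v) \<Rightarrow> bool" where
  "no_fixed_vector A V \<phi> \<longleftrightarrow> fixed_points A \<phi> (carrier V) = {\<zero>\<^bsub>V\<^esub>}"

text \<open>The standing assumptions on the pair, other than the odd order of \<open>A\<close>, are part of the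
  definition.\<close>

definition balanced ::
  "('a, 'm) monoid_scheme \<Rightarrow> (bit, 'v) module \<Rightarrow> ('a \<Rightarrow> 'v \<Rightarrow> 'v) \<Rightarrow> bool" where
  "balanced A V \<phi> \<longleftrightarrow>
     finite_F2_module A V \<phi> \<and> no_fixed_vector A V \<phi> \<and>
     (\<exists>S \<subseteq> carrier V. (\<forall>a \<in> carrier A. \<phi> a ` S \<subseteq> S) \<and> 2 * card S = card (carrier V))"

definition direct_sum_action ::
  "(bit, 'v) module \<Rightarrow> (bit, 'w) module \<Rightarrow> ('a \<Rightarrow> 'v \<Rightarrow> 'v) \<Rightarrow> ('a \<Rightarrow> 'w \<Rightarrow> 'w)
     \<Rightarrow> 'a \<Rightarrow> 'v \<times> 'w \<Rightarrow> 'v \<times> 'w" where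
  "direct_sum_action V V' \<phi> \<phi>' a =
     (\<lambda>x \<in> carrier V \<times> carrier V'. (\<phi> a (fst x), \<phi>' a (snd x)))"


section \<open>The group \<open>B \<rtimes> V\<close>\<close>

definition F2_functions :: "(bit, 'v) module \<Rightarrow> ('v \<Rightarrow> bit) set" where
  "F2_functions V = carrier V \<rightarrow>\<^sub>E UNIV"

definition translate :: "(bit, 'v) module \<Rightarrow> 'v \<Rightarrow> ('v \<Rightarrow> bit) \<Rightarrow> 'v \<Rightarrow> bit" where
  "translate V t f = (\<lambda>x \<in> carrier V. f (x \<oplus>\<^bsub>V\<^esub> t))"

definition BV :: "(bit, 'v) module \<Rightarrow> (('v \<Rightarrow> bit) \<times> 'v) monoid" where
  "BV V =
     \<lparr>carrier = F2_functions V \<times> carrier V,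
      mult = (\<lambda>(f, t) (g, s). (\<lambda>x \<in> carrier V. f x + translate V t g x, t \<oplus>\<^bsub>V\<^esub> s)),
      one = (\<lambda>x \<in> carrier V. 0, \<zero>\<^bsub>V\<^esub>)\<rparr>"

definition BV_action ::
  "('a, 'm) monoid_scheme \<Rightarrow> (bit, 'v) module \<Rightarrow> ('a \<Rightarrow> 'v \<Rightarrow> 'v)
     \<Rightarrow> 'a \<Rightarrow> ('v \<Rightarrow> bit) \<times> 'v \<Rightarrow> ('v \<Rightarrow> bit) \<times> 'v" where
  "BV_action A V \<phi> a =
     (\<lambda>(f, t) \<in> carrier (BV V). (compose (carrier V) f (\<phi> (inv\<^bsub>A\<^esub> a)), \<phi> a t))"


section \<open>Fixed subgroups and invariant irreducible characters\<close>

text \<open>In this section \<open>\<psi>\<close> is an action of \<open>A\<close> on \<open>G\<close> by automorphisms.\<close>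

definition fixed_subgroup ::
  "('a, 'm) monoid_scheme \<Rightarrow> ('a \<Rightarrow> 'g \<Rightarrow> 'g) \<Rightarrow> 'g monoid \<Rightarrow> 'g monoid" where
  "fixed_subgroup A \<psi> G = G\<lparr>carrier := fixed_points A \<psi> (carrier G)\<rparr>"

definition elementary_abelian :: "'g monoid \<Rightarrow> bool" where
  "elementary_abelian G \<longleftrightarrow>
     comm_group G \<and> (\<exists>p::nat. prime p \<and> (\<forall>x \<in> carrier G. x [^]\<^bsub>G\<^esub> p = \<one>\<^bsub>G\<^esub>))"

definition abelianization :: "'g monoid \<Rightarrow> 'g set monoid" where
  "abelianization G = G Mod derived G (carrier G)"

definition complex_rep :: "'g monoid \<Rightarrow> nat \<Rightarrow> ('g \<Rightarrow> complex mat) \<Rightarrow> bool" where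
  "complex_rep G n \<rho> \<longleftrightarrow> \<rho> \<in> hom G (units_of (ring_mat TYPE(complex) n ()))"

definition irreducible_rep :: "'g monoid \<Rightarrow> nat \<Rightarrow> ('g \<Rightarrow> complex mat) \<Rightarrow> bool" where
  "irreducible_rep G n \<rho> \<longleftrightarrow>
     complex_rep G n \<rho> \<and> 0 < n \<and>
     (\<forall>W. VectorSpace.subspace class_ring W (module_vec TYPE(complex) n) \<longrightarrow>
          (\<forall>g \<in> carrier G. \<forall>w \<in> W. \<rho> g *\<^sub>v w \<in> W) \<longrightarrow>
          W = {0\<^sub>v n} \<or> W = carrier_vec n)"

text \<open>Characters are restricted to the carrier, so that distinct elements of \<open>Irr G\<close> are
  distinct as functions on the group and \<open>card\<close> counts them correctly.\<close>

definition rep_character :: "'g monoid \<Rightarrow> nat \<Rightarrow> ('g \<Rightarrow> complex mat) \<Rightarrow> 'g \<Rightarrow> complex" where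
  "rep_character G n \<rho> = (\<lambda>g \<in> carrier G. \<Sum>i<n. \<rho> g $$ (i, i))"

definition Irr :: "'g monoid \<Rightarrow> ('g \<Rightarrow> complex) set" where
  "Irr G = {rep_character G n \<rho> | n \<rho>. irreducible_rep G n \<rho>}"

definition Irr_inv ::
  "('a, 'm) monoid_scheme \<Rightarrow> ('a \<Rightarrow> 'g \<Rightarrow> 'g) \<Rightarrow> 'g monoid \<Rightarrow> ('g \<Rightarrow> complex) set" where
  "Irr_inv A \<psi> G = {\<chi> \<in> Irr G. \<forall>a \<in> carrier A. \<forall>g \<in> carrier G. \<chi> (\<psi> a g) = \<chi> g}"

definition N_inv ::
  "('a, 'm) monoid_scheme \<Rightarrow> ('a \<Rightarrow> 'g \<Rightarrow> 'g) \<Rightarrow> 'g monoid \<Rightarrow> ('g \<Rightarrow> complex) set" where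
  "N_inv A \<psi> G = {\<chi> \<in> Irr_inv A \<psi> G. \<forall>c \<in> carrier (fixed_subgroup A \<psi> G). \<chi> c \<noteq> 0}"

end

theory Submission
  imports Defs
begin

text \<open>If \<open>S\<close> is stable of size \<open>|V|/2\<close>, then so is \<open>S \<times> V'\<close> in \<open>V \<oplus> V'\<close>; doubling a balanced module
  repeatedly makes the dimension arbitrarily large.

  For \<open>G = B \<rtimes> V\<close>, Clifford theory describes the irreducible characters: they are the characters
  \<open>\<chi>\<close> induced from extensions \<open>\<lambda>\<^sub>s \<cdot> \<mu>\<close> to inertia groups, where \<open>s \<in> B\<close> gives the character
  \<open>\<lambda>\<^sub>s(f) = (-1)^(\<Sum>\<^sub>x s(x) f(x))\<close> of \<open>B\<close> and \<open>\<mu>\<close> is a linear character of \<open>V\<close>.  Because \<open>|A|\<close> is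
  odd and \<open>C\<^sub>V(A) = 0\<close>, the group \<open>A\<close> has neither fixed points nor first cohomology on quotients
  of \<open>V\<close>; hence each \<open>A\<close>-invariant \<open>\<chi>\<close> comes from a unique \<open>A\<close>-invariant \<open>s\<close>, with \<open>\<mu>\<close> trivial on
  the stabilizer of \<open>s\<close>.  So \<open>Irr\<^sub>A(G)\<close> is in bijection with the \<open>A\<close>-invariant functions, which
  form \<open>C\<^sub>G(A)\<close>.  The character for \<open>s = \<delta>\<^sub>0\<close> takes at \<open>(f, 0)\<close> the value \<open>\<Sum>\<^sub>x (-1)^f(x)\<close>, which
  vanishes if \<open>f\<close> is the indicator function of a stable set of size \<open>|V|/2\<close>.\<close>

section \<open>Balanced modules\<close>

text \<open>By default the simplifier rewrites sums and products of bits to bit operations.\<close>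

declare add_bit_eq_xor [simp del] mult_bit_eq_and [simp del]

lemma UNIV_bit: "(UNIV :: bit set) = {0, 1}"
  using bit_not_zero_iff by blast

text \<open>Bijectivity comes for free, because \<open>\<phi> (inv a)\<close> inverts
  \<open>\<phi> a\<close> on both sides. Extensionality is assumed because \<open>BijGroup E\<close>
  consists of extensional functions.\<close>

lemma group_actionI:
  assumes "group A"
    and closed: "\<And>a x. a \<in> carrier A \<Longrightarrow> x \<in> E \<Longrightarrow> \<phi> a x \<in> E"
    and ext: "\<And>a. a \<in> carrier A \<Longrightarrow> \<phi> a \<in> extensional E"
    and one: "\<And>x. x \<in> E \<Longrightarrow> \<phi> \<one>\<^bsub>A\<^esub> x = x"
    and mult: "\<And>a b x. a \<in> carrier A \<Longrightarrow> b \<in> carrier A \<Longrightarrow> x \<in> E \<Longrightarrow> \<phi> (a \<otimes>\<^bsub>A\<^esub> b) x = \<phi> a (\<phi> b x)"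
  shows "group_action A E \<phi>"
proof -
  interpret A: group A by fact
  have bij: "\<phi> a \<in> Bij E" if a: "a \<in> carrier A" for a
  proof -
    have "bij_betw (\<phi> a) E E"
    proof (rule bij_betw_byWitness[where f' = "\<phi> (inv\<^bsub>A\<^esub> a)"])
      show "\<forall>x\<in>E. \<phi> (inv\<^bsub>A\<^esub> a) (\<phi> a x) = x" "\<forall>x\<in>E. \<phi> a (\<phi> (inv\<^bsub>A\<^esub> a) x) = x"
        using a by (simp_all flip: mult add: one)
    qed (use a closed in auto)
    then show ?thesis using ext[OF a] by (simp add: Bij_def)
  qed
  have "\<phi> \<in> hom A (BijGroup E)"
  proof (rule homI)
    fix a b assume ab: "a \<in> carrier A" "b \<in> carrier A"
    have "\<phi> (a \<otimes>\<^bsub>A\<^esub> b) = compose E (\<phi> a) (\<phi> b)"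
      using ab ext[of "a \<otimes>\<^bsub>A\<^esub> b"] by (intro extensionalityI[where A = E]) (auto simp: compose_def mult)
    then show "\<phi> (a \<otimes>\<^bsub>A\<^esub> b) = \<phi> a \<otimes>\<^bsub>BijGroup E\<^esub> \<phi> b"
      using bij ab by (simp add: BijGroup_def)
  qed (simp add: bij BijGroup_def)
  then show ?thesis
    by (simp add: group_action_def group_hom_def group_hom_axioms_def \<open>group A\<close> group_BijGroup)
qed

lemma linear_mapI:
  assumes "vectorspace K V" "vectorspace K W"
    and "\<And>x. x \<in> carrier V \<Longrightarrow> f x \<in> carrier W"
    and "\<And>x y. x \<in> carrier V \<Longrightarrow> y \<in> carrier V \<Longrightarrow> f (x \<oplus>\<^bsub>V\<^esub> y) = f x \<oplus>\<^bsub>W\<^esub> f y"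
    and "\<And>c x. c \<in> carrier K \<Longrightarrow> x \<in> carrier V \<Longrightarrow> f (c \<odot>\<^bsub>V\<^esub> x) = c \<odot>\<^bsub>W\<^esub> f x"
  shows "linear_map K V W f"
  using assms 
  unfolding linear_map_def mod_hom_def mod_hom_axioms_def LinearCombinations.module_hom_def vectorspace_def by auto

context finite_F2_module
begin

sublocale V: vectorspace F2 V by (rule vectorspace)

sublocale action: group_action A "carrier V" \<phi> by (rule action)

sublocale A: group A using action.group_hom by (simp add: group_hom_def)

lemma act_closed [simp]: "a \<in> carrier A \<Longrightarrow> x \<in> carrier V \<Longrightarrow> \<phi> a x \<in> carrier V"
  using action.element_image by blast

lemma act_add:
  "a \<in> carrier A \<Longrightarrow> x \<in> carrier V \<Longrightarrow> y \<in> carrier V \<Longrightarrow> \<phi> a (x \<oplus>\<^bsub>V\<^esub> y) = \<phi> a x \<oplus>\<^bsub>V\<^esub> \<phi> a y"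
  using linear by (auto simp: linear_map_def mod_hom_def mod_hom_axioms_def LinearCombinations.module_hom_def)

lemma act_smult:
  "a \<in> carrier A \<Longrightarrow> x \<in> carrier V \<Longrightarrow> \<phi> a (c \<odot>\<^bsub>V\<^esub> x) = c \<odot>\<^bsub>V\<^esub> \<phi> a x"
  using linear by (auto simp: linear_map_def mod_hom_def mod_hom_axioms_def LinearCombinations.module_hom_def)

lemma act_mult:
  "a \<in> carrier A \<Longrightarrow> b \<in> carrier A \<Longrightarrow> x \<in> carrier V \<Longrightarrow> \<phi> (a \<otimes>\<^bsub>A\<^esub> b) x = \<phi> a (\<phi> b x)"
  by (rule action.composition_rule)

lemma act_one [simp]: "x \<in> carrier V \<Longrightarrow> \<phi> \<one>\<^bsub>A\<^esub> x = x"
  using fun_cong[OF action.id_eq_one, of x] by simp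

lemma act_zero [simp]: "a \<in> carrier A \<Longrightarrow> \<phi> a \<zero>\<^bsub>V\<^esub> = \<zero>\<^bsub>V\<^esub>"
  using act_smult[of a "\<zero>\<^bsub>V\<^esub>" 0] V.lmult_0 act_closed by simp

end

lemma finite_F2_moduleI:
  assumes "vectorspace F2 V" "finite (carrier V)" "group A"
    and "\<And>a x. a \<in> carrier A \<Longrightarrow> x \<in> carrier V \<Longrightarrow> \<phi> a x \<in> carrier V"
    and "\<And>a. a \<in> carrier A \<Longrightarrow> \<phi> a \<in> extensional (carrier V)"
    and "\<And>x. x \<in> carrier V \<Longrightarrow> \<phi> \<one>\<^bsub>A\<^esub> x = x"
    and "\<And>a b x. a \<in> carrier A \<Longrightarrow> b \<in> carrier A \<Longrightarrow> x \<in> carrier V \<Longrightarrow> \<phi> (a \<otimes>\<^bsub>A\<^esub> b) x = \<phi> a (\<phi> b x)"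
    and "\<And>a x y. a \<in> carrier A \<Longrightarrow> x \<in> carrier V \<Longrightarrow> y \<in> carrier V \<Longrightarrow> \<phi> a (x \<oplus>\<^bsub>V\<^esub> y) = \<phi> a x \<oplus>\<^bsub>V\<^esub> \<phi> a y"
    and "\<And>a c x. a \<in> carrier A \<Longrightarrow> x \<in> carrier V \<Longrightarrow> \<phi> a (c \<odot>\<^bsub>V\<^esub> x) = c \<odot>\<^bsub>V\<^esub> \<phi> a x"
  shows "finite_F2_module A V \<phi>"
proof (rule finite_F2_module.intro)
  show "group_action A (carrier V) \<phi>" using assms(3-7) by (rule group_actionI)
  show "linear_map F2 V V (\<phi> a)" if "a \<in> carrier A" for a
    using assms(1,1) by (rule linear_mapI) (use that assms(4,8,9) in simp_all)
qed (fact assms)+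

lemma finite_F2_module_direct_sum:
  assumes "finite_F2_module A V \<phi>" "finite_F2_module A V' \<phi>'"
  shows "finite_F2_module A (direct_sum V V') (direct_sum_action V V' \<phi> \<phi>')"
proof -
  interpret V: finite_F2_module A V \<phi> by fact
  interpret V': finite_F2_module A V' \<phi>' by fact
  show ?thesis
  proof (rule finite_F2_moduleI)
    show "vectorspace F2 (direct_sum V V')"
      using direct_sum_is_module[OF V.V.module_axioms V'.V.module_axioms] class_field
      by (simp add: vectorspace_def)
    show "finite (carrier (direct_sum V V'))"
      by (simp add: direct_sum_def V.finite_carrier V'.finite_carrier)
  qed (auto simp: direct_sum_def direct_sum_action_def V.act_mult V'.act_mult V.act_add V'.act_add
      V.act_smult V'.act_smult V.V.smult_closed[simplified] V'.V.smult_closed[simplified])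
qed

lemma no_fixed_vector_direct_sum:
  assumes "finite_F2_module A V \<phi>" "finite_F2_module A V' \<phi>'"
    and "no_fixed_vector A V \<phi>" "no_fixed_vector A V' \<phi>'"
  shows "no_fixed_vector A (direct_sum V V') (direct_sum_action V V' \<phi> \<phi>')"
proof -
  have "fixed_points A (direct_sum_action V V' \<phi> \<phi>') (carrier (direct_sum V V')) =
      fixed_points A \<phi> (carrier V) \<times> fixed_points A \<phi>' (carrier V')"
    by (auto simp: fixed_points_def direct_sum_def direct_sum_action_def)
  then show ?thesis
    using assms by (simp add: no_fixed_vector_def) (simp add: direct_sum_def)
qed

lemma balanced_direct_sum:
  assumes "balanced A V \<phi>" "finite_F2_module A V' \<phi>'" "no_fixed_vector A V' \<phi>'"
  shows "balanced A (direct_sum V V') (direct_sum_action V V' \<phi> \<phi>')"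
proof -
  interpret V': finite_F2_module A V' \<phi>' by fact
  obtain S where S: "S \<subseteq> carrier V" "\<forall>a \<in> carrier A. \<phi> a ` S \<subseteq> S" "2 * card S = card (carrier V)"
    using assms(1) by (auto simp: balanced_def)
  show ?thesis unfolding balanced_def
  proof (intro conjI exI[of _ "S \<times> carrier V'"])
    show "\<forall>a\<in>carrier A. direct_sum_action V V' \<phi> \<phi>' a ` (S \<times> carrier V') \<subseteq> S \<times> carrier V'"
      using S by (auto simp: direct_sum_action_def image_subset_iff)
    show "2 * card (S \<times> carrier V') = card (carrier (direct_sum V V'))"
      by (simp add: direct_sum_def card_cartesian_product flip: S(3))
    show "S \<times> carrier V' \<subseteq> carrier (direct_sum V V')"
      using S(1) by (auto simp: direct_sum_def)
  qed (use assms in \<open>simp_all add: balanced_def finite_F2_module_direct_sum no_fixed_vector_direct_sum\<close>)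
qed

section \<open>Copies of modules along injections, and balanced modules of growing size\<close>

definition transport_module :: "('v \<Rightarrow> 'w) \<Rightarrow> ('k, 'v) module \<Rightarrow> ('k, 'w) module" where
  "transport_module h V =
     (let g = the_inv_into (carrier V) h in
      \<lparr>carrier = h ` carrier V,
       mult = (\<lambda>x y. h \<zero>\<^bsub>V\<^esub>), one = h \<zero>\<^bsub>V\<^esub>, zero = h \<zero>\<^bsub>V\<^esub>,
       add = (\<lambda>x y. h (g x \<oplus>\<^bsub>V\<^esub> g y)),
       smult = (\<lambda>c x. h (c \<odot>\<^bsub>V\<^esub> g x))\<rparr>)"

definition transport_action :: "('v \<Rightarrow> 'w) \<Rightarrow> ('k, 'v) module \<Rightarrow> ('a \<Rightarrow> 'v \<Rightarrow> 'v) \<Rightarrow> 'a \<Rightarrow> 'w \<Rightarrow> 'w" where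
  "transport_action h V \<phi> a =
     (\<lambda>x \<in> h ` carrier V. h (\<phi> a (the_inv_into (carrier V) h x)))"

lemma module_transport:
  assumes "Module.module R V" and inj: "inj_on h (carrier V)"
  shows "Module.module R (transport_module h V)"
proof -
  interpret V: Module.module R V by fact
  note [simp] = transport_module_def Let_def the_inv_into_f_f[OF inj]
  show ?thesis
  proof (rule moduleI)
    show "abelian_group (transport_module h V)"
    proof (rule abelian_groupI)
      fix x assume "x \<in> carrier (transport_module h V)"
      then obtain v where v: "v \<in> carrier V" "x = h v" by auto
      then show "\<exists>y\<in>carrier (transport_module h V). y \<oplus>\<^bsub>transport_module h V\<^esub> x = \<zero>\<^bsub>transport_module h V\<^esub>"
        by (intro bexI[of _ "h (\<ominus>\<^bsub>V\<^esub> v)"]) (simp_all add: V.M.l_neg)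
    qed (auto simp: V.M.a_ac)
  qed (auto simp: V.R.is_cring V.smult_l_distr V.smult_r_distr V.smult_assoc1)
qed

lemma balanced_transport:
  fixes h :: "'v \<Rightarrow> 'w"
  assumes "balanced A V \<phi>" and inj: "inj_on h (carrier V)"
  shows "balanced A (transport_module h V) (transport_action h V \<phi>)"
proof -
  interpret V: finite_F2_module A V \<phi> using assms by (simp add: balanced_def)
  note [simp] = the_inv_into_f_f[OF inj] V.V.smult_closed[simplified]
  note defs = transport_module_def Let_def transport_action_def
  obtain S where S: "S \<subseteq> carrier V" "\<forall>a \<in> carrier A. \<phi> a ` S \<subseteq> S" "2 * card S = card (carrier V)"
    and nf: "fixed_points A \<phi> (carrier V) = {\<zero>\<^bsub>V\<^esub>}"
    using assms(1) by (auto simp: balanced_def no_fixed_vector_def)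
  have "vectorspace F2 (transport_module h V)"
    using module_transport[OF V.V.module_axioms inj] class_field by (simp add: vectorspace_def)
  then have "finite_F2_module A (transport_module h V) (transport_action h V \<phi>)"
    by (rule finite_F2_moduleI)
      (auto simp: defs V.finite_carrier V.act_mult V.act_add V.act_smult inj_on_eq_iff[OF inj])
  moreover have "fixed_points A (transport_action h V \<phi>) (carrier (transport_module h V)) =
      h ` fixed_points A \<phi> (carrier V)"
    using inj by (auto simp: fixed_points_def defs inj_on_eq_iff)
  then have "no_fixed_vector A (transport_module h V) (transport_action h V \<phi>)"
    unfolding no_fixed_vector_def nf by (simp add: defs)
  moreover have "2 * card (h ` S) = card (carrier (transport_module h V))"
    using S inj inj_on_subset[OF inj S(1)] by (simp add: defs card_image)
  moreover have "transport_action h V \<phi> a ` (h ` S) \<subseteq> h ` S" if "a \<in> carrier A" for a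
  proof -
    have "transport_action h V \<phi> a (h x) = h (\<phi> a x)" if "x \<in> S" for x
      using S(1) that by (auto simp: defs inj_on_eq_iff[OF inj] subset_iff)
    then show ?thesis using S(2) that by (auto simp: image_subset_iff)
  qed
  moreover have "h ` S \<subseteq> carrier (transport_module h V)" using S by (auto simp: defs)
  ultimately show ?thesis
    unfolding balanced_def by (intro conjI exI[of _ "h ` S"] ballI)
qed

lemma card_transport_module:
  "inj_on h (carrier V) \<Longrightarrow> card (carrier (transport_module h V)) = card (carrier V)"
  by (simp add: transport_module_def Let_def card_image)

text \<open>A direct sum lives on a product type, so iterated doubling would leave every fixed type.
  Copying each module into \<open>nat\<close> keeps the iteration in one type.\<close>

lemma balanced_nat:
  assumes "balanced A V \<phi>"
  obtains W :: "(bit, nat) module" and \<psi>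
  where "balanced A W \<psi>" "card (carrier W) = card (carrier V)"
proof -
  interpret V: finite_F2_module A V \<phi> using assms by (simp add: balanced_def)
  obtain h :: "_ \<Rightarrow> nat" where "inj_on h (carrier V)"
    using finite_imp_inj_to_nat_seg[OF V.finite_carrier] by blast
  then show thesis
    using that balanced_transport[OF assms] card_transport_module by blast
qed

text \<open>The size is \<open>2 * card S\<close>, hence even, and it is positive because of the
  zero vector. So squaring it makes it strictly larger.\<close>

lemma card_balanced_gt_1:
  assumes "balanced A V \<phi>"
  shows "1 < card (carrier V)"
proof -
  interpret V: finite_F2_module A V \<phi> using assms by (simp add: balanced_def)
  have "card (carrier V) \<noteq> 0" using V.finite_carrier V.V.M.zero_closed by auto
  moreover have "even (card (carrier V))" using assms unfolding balanced_def by (metis dvd_triv_left)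
  ultimately show ?thesis by presburger
qed

lemma balanced_larger:
  fixes V :: "(bit, 'v) module"
  assumes "balanced A V \<phi>"
  shows "\<exists>(W :: (bit, nat) module) \<psi>. balanced A W \<psi> \<and> card (carrier V) < card (carrier W)"
proof -
  have "balanced A (direct_sum V V) (direct_sum_action V V \<phi> \<phi>)"
    using assms by (intro balanced_direct_sum) (simp_all add: balanced_def)
  then obtain W :: "(bit, nat) module" and \<psi> where
    "balanced A W \<psi>" "card (carrier W) = card (carrier (direct_sum V V))"
    by (rule balanced_nat)
  moreover have "card (carrier V) < card (carrier (direct_sum V V))"
    using card_balanced_gt_1[OF assms] by (simp add: direct_sum_def card_cartesian_product)
  ultimately show ?thesis by metis
qed

lemma balanced_sequence:
  fixes V :: "(bit, 'v) module"
  assumes "balanced A V \<phi>"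
  obtains W :: "nat \<Rightarrow> (bit, nat) module" and \<psi>
  where "\<And>k. balanced A (W k) (\<psi> k)" "strict_mono (\<lambda>k. card (carrier (W k)))"
proof -
  \<comment> \<open>Dependent choice selects one object at a time, so a module and its action are
    chosen as a pair.\<close>
  obtain F :: "nat \<Rightarrow> (bit, nat) module \<times> ('a \<Rightarrow> nat \<Rightarrow> nat)" where
    F: "\<And>k. balanced A (fst (F k)) (snd (F k))"
      "\<And>k. card (carrier (fst (F k))) < card (carrier (fst (F (Suc k))))"
  proof (atomize_elim, unfold all_conj_distrib[symmetric], rule dependent_nat_choice)
    show "\<exists>F :: (bit, nat) module \<times> ('a \<Rightarrow> nat \<Rightarrow> nat). balanced A (fst F) (snd F)"
      using balanced_larger[OF assms] by auto
  next
    fix F :: "(bit, nat) module \<times> ('a \<Rightarrow> nat \<Rightarrow> nat)" and k :: nat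
    assume "balanced A (fst F) (snd F)"
    from balanced_larger[OF this]
    show "\<exists>F' :: (bit, nat) module \<times> ('a \<Rightarrow> nat \<Rightarrow> nat).
        balanced A (fst F') (snd F') \<and> card (carrier (fst F)) < card (carrier (fst F'))"
      by auto
  qed
  then show thesis
    using that[of "\<lambda>k. fst (F k)" "\<lambda>k. snd (F k)"] by (simp add: strict_mono_Suc_iff)
qed

text \<open>Coordinates with respect to a basis \<open>B\<close> present the space as an image of
  the functions from \<open>B\<close> to the field. This turns growth of cardinality into growth of
  dimension.\<close>

lemma card_le_two_power_dim:
  assumes "vectorspace F2 V" "finite (carrier V)"
  shows "card (carrier V) \<le> 2 ^ vectorspace.dim F2 V"
proof -
  interpret V: vectorspace F2 V by fact
  \<comment> \<open>A finite carrier is a finite generating set of itself.\<close>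
  have "V.gen_set (carrier V)"
    using V.in_own_span[of "carrier V"] V.span_is_subset2[of "carrier V"] by auto
  then have "V.fin_dim" using assms(2) by (auto simp: V.fin_dim_def)
  then obtain B where B: "finite B" "V.basis B" using V.finite_basis_exists by auto
  have crit: "\<forall>v. v \<in> carrier V \<longrightarrow> (\<exists>!c. c \<in> B \<rightarrow>\<^sub>E carrier F2 \<and> V.lincomb c B = v)"
    using V.basis_criterion[OF B(1)] B(2) V.basis_def by metis
  have "carrier V \<subseteq> (\<lambda>c. V.lincomb c B) ` (B \<rightarrow>\<^sub>E UNIV)"
  proof
    fix x assume "x \<in> carrier V"
    with crit have "\<exists>!c. c \<in> B \<rightarrow>\<^sub>E UNIV \<and> V.lincomb c B = x" by simp
    then show "x \<in> (\<lambda>c. V.lincomb c B) ` (B \<rightarrow>\<^sub>E UNIV)" by blast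
  qed
  then have "card (carrier V) \<le> card (B \<rightarrow>\<^sub>E (UNIV :: bit set))"
    using B(1) by (intro surj_card_le) (simp_all add: finite_PiE UNIV_bit)
  also have "\<dots> = 2 ^ card B"
    using B(1) by (simp add: card_PiE UNIV_bit numeral_2_eq_2)
  also have "card B = V.dim" using V.dim_basis B by simp
  finally show ?thesis .
qed

section \<open>Complex representations\<close>

lemma complex_rep_carrier:
  assumes "complex_rep G n \<rho>" "g \<in> carrier G"
  shows "\<rho> g \<in> carrier_mat n n"
proof -
  have "\<rho> g \<in> carrier (units_of (ring_mat TYPE(complex) n ()))"
    using assms by (auto simp: complex_rep_def hom_def)
  then show ?thesis by (simp add: units_of_def Units_def ring_mat_simps)
qed

lemma complex_rep_mult:
  assumes "complex_rep G n \<rho>" "g \<in> carrier G" "h \<in> carrier G"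
  shows "\<rho> (g \<otimes>\<^bsub>G\<^esub> h) = \<rho> g * \<rho> h"
  using hom_mult[OF assms[unfolded complex_rep_def]] by (simp add: units_of_mult ring_mat_simps)

lemma complex_rep_one:
  assumes "complex_rep G n \<rho>" "group G"
  shows "\<rho> \<one>\<^bsub>G\<^esub> = 1\<^sub>m n"
proof -
  interpret R: semiring "ring_mat TYPE(complex) n ()" by (rule semiring_mat)
  have "group (units_of (ring_mat TYPE(complex) n ()))" by (rule R.units_group)
  then have "\<rho> \<one>\<^bsub>G\<^esub> = \<one>\<^bsub>units_of (ring_mat TYPE(complex) n ())\<^esub>"
    using assms unfolding complex_rep_def by (metis hom_one)
  then show ?thesis by (simp add: units_of_one ring_mat_simps)
qed

text \<open>Multiplicativity makes the image of the group inverse a two-sided inverse matrix, so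
  invertibility need not be assumed.\<close>

lemma complex_repI:
  assumes "group G"
    and closed: "\<And>g. g \<in> carrier G \<Longrightarrow> \<rho> g \<in> carrier_mat n n"
    and one: "\<rho> \<one>\<^bsub>G\<^esub> = 1\<^sub>m n"
    and mult: "\<And>g h. g \<in> carrier G \<Longrightarrow> h \<in> carrier G \<Longrightarrow> \<rho> (g \<otimes>\<^bsub>G\<^esub> h) = \<rho> g * \<rho> h"
  shows "complex_rep G n \<rho>"
proof -
  interpret group G by fact
  have "\<rho> g \<in> Units (ring_mat TYPE(complex) n ())" if g: "g \<in> carrier G" for g
  proof -
    have "\<rho> (inv\<^bsub>G\<^esub> g) * \<rho> g = 1\<^sub>m n" "\<rho> g * \<rho> (inv\<^bsub>G\<^esub> g) = 1\<^sub>m n"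
      using g by (simp_all flip: mult add: one)
    then show ?thesis
      using g closed[OF g] closed[of "inv\<^bsub>G\<^esub> g"] unfolding Units_def by (auto simp: ring_mat_simps)
  qed
  then show ?thesis
    unfolding complex_rep_def hom_def by (auto simp: units_of_def mult ring_mat_simps)
qed

lemma subspace_vecI:
  assumes "W \<subseteq> carrier_vec n" "0\<^sub>v n \<in> W"
    and "\<And>v w. v \<in> W \<Longrightarrow> w \<in> W \<Longrightarrow> v + w \<in> W"
    and "\<And>c v. v \<in> W \<Longrightarrow> c \<cdot>\<^sub>v v \<in> W"
  shows "VectorSpace.subspace class_ring W (module_vec TYPE(complex) n)"
  unfolding VectorSpace.subspace_def LinearCombinations.submodule_def
  using assms vec_vs[where ?'a = complex] vec_module[where ?'a = complex]
  by (auto simp: module_vec_simps)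

lemma subspace_vecD:
  assumes "VectorSpace.subspace class_ring W (module_vec TYPE(complex) n)"
  shows "W \<subseteq> carrier_vec n" "0\<^sub>v n \<in> W"
    "\<And>v w. v \<in> W \<Longrightarrow> w \<in> W \<Longrightarrow> v + w \<in> W"
    "\<And>c v. v \<in> W \<Longrightarrow> c \<cdot>\<^sub>v v \<in> W"
  using assms unfolding VectorSpace.subspace_def LinearCombinations.submodule_def
  by (auto simp: module_vec_simps)

text \<open>Irreducibility in terms of plain closure conditions on a set of vectors, the form in
  which kernels and images of intertwiners are tested.\<close>

lemma irreducible_repD:
  assumes "irreducible_rep G n \<rho>"
    and "W \<subseteq> carrier_vec n" "0\<^sub>v n \<in> W"
    and "\<And>v w. v \<in> W \<Longrightarrow> w \<in> W \<Longrightarrow> v + w \<in> W"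
    and "\<And>c v. v \<in> W \<Longrightarrow> c \<cdot>\<^sub>v v \<in> W"
    and "\<And>g w. g \<in> carrier G \<Longrightarrow> w \<in> W \<Longrightarrow> \<rho> g *\<^sub>v w \<in> W"
  shows "W = {0\<^sub>v n} \<or> W = carrier_vec n"
  using assms(1,6) subspace_vecI[OF assms(2-5)] unfolding irreducible_rep_def by blast

section \<open>Schur's lemma and equality of characters\<close>

lemma trace_mult_commute:
  fixes A :: "complex mat"
  assumes "A \<in> carrier_mat n m" "B \<in> carrier_mat m n"
  shows "(\<Sum>i<n. (A * B) $$ (i, i)) = (\<Sum>j<m. (B * A) $$ (j, j))"
proof -
  have "(\<Sum>i<n. (A * B) $$ (i, i)) = (\<Sum>i<n. \<Sum>j<m. A $$ (i, j) * B $$ (j, i))"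
    using assms by (intro sum.cong) (auto simp: scalar_prod_def atLeast0LessThan)
  also have "\<dots> = (\<Sum>j<m. \<Sum>i<n. B $$ (j, i) * A $$ (i, j))"
    by (subst sum.swap) (simp add: mult.commute)
  also have "\<dots> = (\<Sum>j<m. (B * A) $$ (j, j))"
    using assms by (intro sum.cong) (auto simp: scalar_prod_def atLeast0LessThan)
  finally show ?thesis .
qed

lemma mult_mat_vec_unit_vec:
  fixes A :: "'k :: comm_semiring_1 mat"
  assumes "A \<in> carrier_mat n m" "j < m"
  shows "A *\<^sub>v unit_vec m j = col A j"
  using assms by (intro eq_vecI) auto

text \<open>Schur's lemma: kernel and image of \<open>P\<close> are invariant subspaces. As
  \<open>P\<close> is nonzero, the kernel is not everything, so it is zero; then the image is not
  zero, so it is everything.\<close>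

lemma irreducible_intertwiner_invertible:
  assumes irr: "irreducible_rep G n \<rho>" "irreducible_rep G m \<sigma>"
    and P: "P \<in> carrier_mat n m" "P \<noteq> 0\<^sub>m n m"
    and inter: "\<And>g. g \<in> carrier G \<Longrightarrow> \<rho> g * P = P * \<sigma> g"
  obtains Q where "Q \<in> carrier_mat m n" "P * Q = 1\<^sub>m n" "Q * P = 1\<^sub>m m"
proof -
  have rep: "complex_rep G n \<rho>" "complex_rep G m \<sigma>"
    using irr by (auto simp: irreducible_rep_def)
  have inter_vec: "\<rho> g *\<^sub>v (P *\<^sub>v v) = P *\<^sub>v (\<sigma> g *\<^sub>v v)"
    if "g \<in> carrier G" "v \<in> carrier_vec m" for g v
    using inter[OF that(1)] that P(1) complex_rep_carrier[OF rep(1) that(1)]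
      complex_rep_carrier[OF rep(2) that(1)]
    by (metis assoc_mult_mat_vec)
  define K where "K = {v \<in> carrier_vec m. P *\<^sub>v v = 0\<^sub>v n}"
  have "K = {0\<^sub>v m} \<or> K = carrier_vec m"
  proof (rule irreducible_repD[OF irr(2)])
    fix g w assume gw: "g \<in> carrier G" "w \<in> K"
    then have "\<rho> g *\<^sub>v (P *\<^sub>v w) = 0\<^sub>v n"
      using complex_rep_carrier[OF rep(1) gw(1)] by (auto simp: K_def)
    then show "\<sigma> g *\<^sub>v w \<in> K"
      using gw inter_vec[OF gw(1), of w] complex_rep_carrier[OF rep(2) gw(1)] by (auto simp: K_def)
  qed (use P(1) in \<open>auto simp: K_def mult_add_distrib_mat_vec[of _ n m] mult_mat_vec[of _ n m]\<close>)
  \<comment> \<open>The columns of a matrix are the images of the unit vectors, so a matrix that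
    kills all vectors is zero.\<close>
  moreover have "K \<noteq> carrier_vec m"
  proof
    assume K: "K = carrier_vec m"
    have "P = 0\<^sub>m n m"
    proof (rule mat_col_eqI)
      fix j assume j: "j < dim_col (0\<^sub>m n m :: complex mat)"
      then have "unit_vec m j \<in> K" by (simp add: K)
      then show "col P j = col (0\<^sub>m n m) j"
        using j P(1) by (simp add: K_def mult_mat_vec_unit_vec)
    qed (use P in auto)
    then show False using P(2) by simp
  qed
  ultimately have ker: "v = 0\<^sub>v m" if "v \<in> carrier_vec m" "P *\<^sub>v v = 0\<^sub>v n" for v
    using that unfolding K_def by blast
  define I where "I = (*\<^sub>v) P ` carrier_vec m"
  have "I = {0\<^sub>v n} \<or> I = carrier_vec n"
  proof (rule irreducible_repD[OF irr(1)])
    show "I \<subseteq> carrier_vec n" using P(1) by (auto simp: I_def)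
    show "0\<^sub>v n \<in> I" using P(1) by (auto simp: I_def intro!: image_eqI[of _ _ "0\<^sub>v m"])
    show "v + w \<in> I" if "v \<in> I" "w \<in> I" for v w
    proof -
      from that obtain v' w' where "v' \<in> carrier_vec m" "v = P *\<^sub>v v'" "w' \<in> carrier_vec m" "w = P *\<^sub>v w'"
        by (auto simp: I_def)
      then show ?thesis using P(1)
        by (auto simp: I_def mult_add_distrib_mat_vec[of _ n m] intro!: image_eqI[of _ _ "v' + w'"])
    qed
    show "c \<cdot>\<^sub>v v \<in> I" if "v \<in> I" for c v
    proof -
      from that obtain v' where "v' \<in> carrier_vec m" "v = P *\<^sub>v v'"
        by (auto simp: I_def)
      then show ?thesis using P(1)
        by (auto simp: I_def mult_mat_vec[of _ n m] intro!: image_eqI[of _ _ "c \<cdot>\<^sub>v v'"])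
    qed
    show "\<rho> g *\<^sub>v w \<in> I" if "g \<in> carrier G" "w \<in> I" for g w
      using that inter_vec complex_rep_carrier[OF rep(2)] by (fastforce simp: I_def)
  qed
  moreover have "I \<noteq> {0\<^sub>v n}"
    using ker \<open>K \<noteq> carrier_vec m\<close> by (auto simp: I_def K_def)
  ultimately have "\<forall>i<n. \<exists>q \<in> carrier_vec m. P *\<^sub>v q = unit_vec n i"
    by (metis I_def image_iff unit_vec_carrier)
  then obtain q where q: "\<And>i. i < n \<Longrightarrow> q i \<in> carrier_vec m" "\<And>i. i < n \<Longrightarrow> P *\<^sub>v q i = unit_vec n i"
    by metis
  \<comment> \<open>The columns of \<open>Q\<close> are the chosen preimages of the unit vectors,
    which makes it a right inverse of \<open>P\<close>.\<close>
  define Q where "Q = mat m n (\<lambda>(i, j). q j $ i)"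
  have Q: "Q \<in> carrier_mat m n" by (simp add: Q_def)
  have col_Q: "col Q j = q j" if "j < n" for j
    using q(1)[OF that] that by (intro eq_vecI) (auto simp: Q_def)
  have PQ: "P * Q = 1\<^sub>m n"
  proof (rule mat_col_eqI)
    fix j assume "j < dim_col (1\<^sub>m n :: complex mat)"
    then have j: "j < n" by simp
    have "col (P * Q) j = P *\<^sub>v q j" by (simp only: col_mult2[OF P(1) Q j] col_Q[OF j])
    then show "col (P * Q) j = col (1\<^sub>m n) j" using j q(2)[OF j] by simp
  qed (use P Q in auto)
  have "Q * P = 1\<^sub>m m"
  proof (rule mat_col_eqI)
    fix j assume "j < dim_col (1\<^sub>m m :: complex mat)"
    then have j: "j < m" by simp
    have colP: "col P j \<in> carrier_vec n" using P(1) by auto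
    have Qc: "Q *\<^sub>v col P j \<in> carrier_vec m" using Q colP by simp
    have "P *\<^sub>v (Q *\<^sub>v col P j) = (P * Q) *\<^sub>v col P j"
      using P(1) Q colP by simp
    also have "\<dots> = col P j" using colP by (simp add: PQ)
    \<comment> \<open>For the left inverse: \<open>P\<close> takes the same value at
      \<open>Q *\<^sub>v col P j\<close> and at the unit vector, and its kernel is zero.\<close>
    finally have "P *\<^sub>v (Q *\<^sub>v col P j - unit_vec m j) = 0\<^sub>v n"
      using P(1) Qc colP j by (simp add: mult_minus_distrib_mat_vec[OF P(1)] mult_mat_vec_unit_vec)
    then have "Q *\<^sub>v col P j - unit_vec m j = 0\<^sub>v m" using ker Qc by simp
    then have "Q *\<^sub>v col P j = unit_vec m j"
      using Qc Q by (intro eq_vecI) (auto simp: vec_eq_iff)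
    then show "col (Q * P) j = col (1\<^sub>m m) j"
      using j col_mult2[OF Q P(1) j] by simp
  qed (use P Q in auto)
  then show thesis using that Q PQ by blast
qed

text \<open>The traces agree because \<open>\<rho> g = P \<sigma>(g) Q\<close>; this avoids a comparison of dimensions.\<close>

lemma irreducible_intertwiner_character:
  assumes irr: "irreducible_rep G n \<rho>" "irreducible_rep G m \<sigma>"
    and P: "P \<in> carrier_mat n m" "P \<noteq> 0\<^sub>m n m"
    and inter: "\<And>g. g \<in> carrier G \<Longrightarrow> \<rho> g * P = P * \<sigma> g"
  shows "rep_character G n \<rho> = rep_character G m \<sigma>"
proof -
  obtain Q where Q: "Q \<in> carrier_mat m n" "P * Q = 1\<^sub>m n" "Q * P = 1\<^sub>m m"
    using irreducible_intertwiner_invertible[OF assms] by blast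
  have rep: "complex_rep G n \<rho>" "complex_rep G m \<sigma>"
    using irr by (auto simp: irreducible_rep_def)
  have "(\<Sum>i<n. \<rho> g $$ (i, i)) = (\<Sum>j<m. \<sigma> g $$ (j, j))" if g: "g \<in> carrier G" for g
  proof -
    note c = complex_rep_carrier[OF rep(1) g] complex_rep_carrier[OF rep(2) g]
    have "\<rho> g = (\<rho> g * P) * Q"
      using c P(1) Q by (simp add: assoc_mult_mat[of _ n n _ m _ n])
    also have "\<dots> = (P * \<sigma> g) * Q" by (simp add: inter[OF g])
    finally have "(\<Sum>i<n. \<rho> g $$ (i, i)) = (\<Sum>j<m. (Q * (P * \<sigma> g)) $$ (j, j))"
      using trace_mult_commute[of "P * \<sigma> g" n m Q] c P(1) Q(1) by simp
    also have "Q * (P * \<sigma> g) = \<sigma> g"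
      using c P(1) Q by (simp flip: assoc_mult_mat[of _ m n _ m _ m])
    finally show ?thesis .
  qed
  then show ?thesis by (auto simp: rep_character_def)
qed

text \<open>Induction over the set of involutions: the current vector is replaced by an eigenvector
  of the next one, and commutation preserves the eigenvalues already secured.\<close>

lemma common_eigenvector_involutions:
  fixes T :: "'t \<Rightarrow> complex mat"
  assumes "finite K" and "0 < n"
    and carrier: "\<And>t. t \<in> K \<Longrightarrow> T t \<in> carrier_mat n n"
    and invol: "\<And>t. t \<in> K \<Longrightarrow> T t * T t = 1\<^sub>m n"
    and comm: "\<And>s t. s \<in> K \<Longrightarrow> t \<in> K \<Longrightarrow> T s * T t = T t * T s"
  shows "\<exists>u \<in> carrier_vec n. u \<noteq> 0\<^sub>v n \<and> (\<forall>t \<in> K. \<exists>e. (e = 1 \<or> e = -1) \<and> T t *\<^sub>v u = e \<cdot>\<^sub>v u)"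
proof -
  have "\<exists>u \<in> carrier_vec n. u \<noteq> 0\<^sub>v n \<and> (\<forall>t \<in> L. \<exists>e. (e = 1 \<or> e = -1) \<and> T t *\<^sub>v u = e \<cdot>\<^sub>v u)"
    if "finite L" "L \<subseteq> K" for L
    using that
  proof induction
    case empty
    have "unit_vec n 0 \<noteq> (0\<^sub>v n :: complex vec)" using \<open>0 < n\<close> by simp
    then show ?case by (intro bexI[of _ "unit_vec n 0"]) auto
  next
    case (insert t L)
    then obtain u where u: "u \<in> carrier_vec n" "u \<noteq> 0\<^sub>v n"
      "\<And>s. s \<in> L \<Longrightarrow> \<exists>e. (e = 1 \<or> e = -1) \<and> T s *\<^sub>v u = e \<cdot>\<^sub>v u" by auto
    have t: "T t \<in> carrier_mat n n" using carrier insert by auto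
    \<comment> \<open>Up to the factor 2 this is the projection of \<open>u\<close> to the
      eigenspace of 1. If it vanishes, \<open>u\<close> itself is an eigenvector for -1.\<close>
    define w where "w = u + T t *\<^sub>v u"
    have w: "w \<in> carrier_vec n" using u t by (simp add: w_def)
    show ?case
    proof (cases "w = 0\<^sub>v n")
      case True
      then have "T t *\<^sub>v u = (-1) \<cdot>\<^sub>v u"
        using u(1) t unfolding w_def
        by (intro eq_vecI) (auto simp: vec_eq_iff eq_neg_iff_add_eq_0 add.commute)
      then show ?thesis using u by (intro bexI[of _ u]) auto
    next
      case False
      have "T t *\<^sub>v (T t *\<^sub>v u) = u"
        using u(1) t invol[of t] insert by (simp flip: assoc_mult_mat_vec)
      then have "T t *\<^sub>v w = 1 \<cdot>\<^sub>v w"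
        using u(1) t by (simp add: w_def mult_add_distrib_mat_vec[OF t] comm_add_vec[of _ n])
      moreover have "\<exists>e. (e = 1 \<or> e = -1) \<and> T s *\<^sub>v w = e \<cdot>\<^sub>v w" if s: "s \<in> L" for s
      proof -
        obtain e where e: "e = 1 \<or> e = -1" "T s *\<^sub>v u = e \<cdot>\<^sub>v u" using u(3)[OF s] by blast
        have Ts: "T s \<in> carrier_mat n n" using s insert carrier by auto
        have "T s *\<^sub>v (T t *\<^sub>v u) = T t *\<^sub>v (T s *\<^sub>v u)"
          using Ts t u(1) comm[of s t] s insert by (auto simp flip: assoc_mult_mat_vec)
        then have "T s *\<^sub>v w = e \<cdot>\<^sub>v w"
          using u(1) t Ts e by (simp add: w_def mult_add_distrib_mat_vec[OF Ts] mult_mat_vec[OF t]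
            smult_add_distrib_vec[of _ n])
        then show ?thesis using e(1) by blast
      qed
      ultimately show ?thesis using w False by (intro bexI[of _ w]) auto
    qed
  qed
  then show ?thesis using \<open>finite K\<close> by blast
qed

section \<open>The irreducible characters of \<open>B \<rtimes> V\<close>\<close>

text \<open>Sums of vectors are written coordinatewise, so that they can be rearranged as ordinary
  complex sums.\<close>

lemma vec_sum_in_subspace:
  fixes W :: "complex vec set"
  assumes "W \<subseteq> carrier_vec n" "0\<^sub>v n \<in> W"
    and add: "\<And>v w. v \<in> W \<Longrightarrow> w \<in> W \<Longrightarrow> v + w \<in> W"
    and smult: "\<And>c v. v \<in> W \<Longrightarrow> c \<cdot>\<^sub>v v \<in> W"
    and "finite F" "\<And>f. f \<in> F \<Longrightarrow> v f \<in> W"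
  shows "vec n (\<lambda>i. \<Sum>f\<in>F. c f * v f $ i) \<in> W"
  using assms(5,6)
proof (induction F)
  case empty
  have "vec n (\<lambda>i. 0) = (0\<^sub>v n :: complex vec)" by auto
  then show ?case using assms(2) by simp
next
  case (insert f F)
  have "v f \<in> carrier_vec n" using insert assms(1) by auto
  then have "vec n (\<lambda>i. \<Sum>f\<in>insert f F. c f * v f $ i) =
      c f \<cdot>\<^sub>v v f + vec n (\<lambda>i. \<Sum>f\<in>F. c f * v f $ i)"
    using insert by (intro eq_vecI) auto
  then show ?case using insert add smult by auto
qed

lemma mult_mat_vec_sum:
  fixes M :: "complex mat"
  assumes "M \<in> carrier_mat m n" "\<And>f. f \<in> F \<Longrightarrow> v f \<in> carrier_vec n" "i < m"
  shows "(M *\<^sub>v vec n (\<lambda>i. \<Sum>f\<in>F. c f * v f $ i)) $ i = (\<Sum>f\<in>F. c f * (M *\<^sub>v v f) $ i)"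
proof -
  have "(M *\<^sub>v vec n (\<lambda>i. \<Sum>f\<in>F. c f * v f $ i)) $ i =
      (\<Sum>j<n. \<Sum>f\<in>F. M $$ (i, j) * (c f * v f $ j))"
    using assms(1,3) by (simp add: scalar_prod_def atLeast0LessThan sum_distrib_left)
  also have "\<dots> = (\<Sum>f\<in>F. \<Sum>j<n. c f * (M $$ (i, j) * v f $ j))"
    by (subst sum.swap) (simp add: algebra_simps)
  also have "\<dots> = (\<Sum>f\<in>F. c f * (M *\<^sub>v v f) $ i)"
  proof (rule sum.cong[OF refl])
    fix f assume "f \<in> F"
    then have "dim_vec (v f) = n" using assms(2) by auto
    then show "(\<Sum>j<n. c f * (M $$ (i, j) * v f $ j)) = c f * (M *\<^sub>v v f) $ i"
      using assms(1,3) by (simp add: scalar_prod_def atLeast0LessThan sum_distrib_left)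
  qed
  finally show ?thesis .
qed

text \<open>The nontrivial linear character of the additive group of the field with two
  elements.\<close>

definition bit_sign :: "bit \<Rightarrow> complex" where
  "bit_sign b = (if b = 0 then 1 else -1)"

lemma bit_sign_0 [simp]: "bit_sign 0 = 1"
  and bit_sign_1 [simp]: "bit_sign 1 = -1"
  by (simp_all add: bit_sign_def)

lemma bit_sign_add: "bit_sign (a + b) = bit_sign a * bit_sign b"
  by (cases a; cases b) (simp_all add: add_bit_eq_xor)

lemma bit_sign_cases: "bit_sign b = 1 \<or> bit_sign b = -1"
  by (simp add: bit_sign_def)

lemma bit_add_self [simp]: "b + b = (0 :: bit)"
  by (cases b) (simp_all add: add_bit_eq_xor)

section \<open>The group \<open>B \<rtimes> V\<close> and the characters of \<open>B\<close>,
  without an action of \<open>A\<close>\<close>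

locale finite_F2_space = V: vectorspace F2 V for V :: "(bit, 'v) module" +
  assumes finite_space: "finite (carrier V)"
begin

text \<open>Every vector is its own negative since 1 + 1 = 0. Hence translations are involutions,
  and below sums stand wherever differences would be expected.\<close>

lemma add_self [simp]: "x \<in> carrier V \<Longrightarrow> x \<oplus>\<^bsub>V\<^esub> x = \<zero>\<^bsub>V\<^esub>"
  using V.smult_l_distr[of 1 1 x] V.smult_one[of x] V.lmult_0[of x] by (simp del: V.smult_one)

lemma add_add_self [simp]: "x \<in> carrier V \<Longrightarrow> t \<in> carrier V \<Longrightarrow> x \<oplus>\<^bsub>V\<^esub> t \<oplus>\<^bsub>V\<^esub> t = x"
  by (simp add: V.M.a_assoc)

lemma F2_functions_eq: "F2_functions V = extensional (carrier V)"
  by (auto simp: F2_functions_def PiE_def)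

lemma finite_F2_functions [simp]: "finite (F2_functions V)"
  unfolding F2_functions_def by (intro finite_PiE) (simp_all add: finite_space UNIV_bit)

lemma card_F2_functions: "card (F2_functions V) = 2 ^ card (carrier V)"
  unfolding F2_functions_def using finite_space
  by (simp add: card_PiE UNIV_bit numeral_2_eq_2)

lemma F2_functions_eqI:
  assumes "f \<in> F2_functions V" "g \<in> F2_functions V" "\<And>x. x \<in> carrier V \<Longrightarrow> f x = g x"
  shows "f = g"
  using assms unfolding F2_functions_eq by (rule extensionalityI)

abbreviation fzero :: "'v \<Rightarrow> bit" where
  "fzero \<equiv> \<lambda>x \<in> carrier V. 0"

definition fadd :: "('v \<Rightarrow> bit) \<Rightarrow> ('v \<Rightarrow> bit) \<Rightarrow> 'v \<Rightarrow> bit" where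
  "fadd f g = (\<lambda>x \<in> carrier V. f x + g x)"

lemma fzero_closed [simp]: "fzero \<in> F2_functions V"
  by (simp add: F2_functions_eq)

lemma fadd_closed [simp]: "fadd f g \<in> F2_functions V"
  by (simp add: F2_functions_eq fadd_def)

lemma fadd_apply [simp]: "x \<in> carrier V \<Longrightarrow> fadd f g x = f x + g x"
  by (simp add: fadd_def)

lemma translate_closed [simp]: "translate V t f \<in> F2_functions V"
  by (simp add: F2_functions_eq translate_def)

lemma translate_apply [simp]: "x \<in> carrier V \<Longrightarrow> translate V t f x = f (x \<oplus>\<^bsub>V\<^esub> t)"
  by (simp add: translate_def)

lemma translate_translate [simp]:
  "t \<in> carrier V \<Longrightarrow> u \<in> carrier V \<Longrightarrow> translate V t (translate V u f) = translate V (t \<oplus>\<^bsub>V\<^esub> u) f"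
  by (rule F2_functions_eqI) (simp_all add: V.M.a_ac)

lemma translate_zero [simp]: "f \<in> F2_functions V \<Longrightarrow> translate V \<zero>\<^bsub>V\<^esub> f = f"
  by (rule F2_functions_eqI) simp_all

lemma translate_fzero [simp]: "t \<in> carrier V \<Longrightarrow> translate V t fzero = fzero"
  by (rule F2_functions_eqI) simp_all

lemma translate_fadd:
  "t \<in> carrier V \<Longrightarrow> translate V t (fadd f g) = fadd (translate V t f) (translate V t g)"
  by (rule F2_functions_eqI) simp_all

lemma fadd_fzero [simp]: "f \<in> F2_functions V \<Longrightarrow> fadd f fzero = f" "f \<in> F2_functions V \<Longrightarrow> fadd fzero f = f"
  by (rule F2_functions_eqI; simp)+

lemma fadd_self [simp]: "fadd f f = fzero"
  by (rule F2_functions_eqI) simp_all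

lemma fadd_assoc: "fadd (fadd f g) h = fadd f (fadd g h)"
  by (rule F2_functions_eqI) (simp_all add: add.assoc)

lemma fadd_commute: "fadd f g = fadd g f"
  by (rule F2_functions_eqI) (simp_all add: add.commute)

lemma fadd_cancel [simp]: "g \<in> F2_functions V \<Longrightarrow> fadd f (fadd f g) = g"
  by (simp flip: fadd_assoc)

lemma carrier_BV [simp]: "carrier (BV V) = F2_functions V \<times> carrier V"
  by (simp add: BV_def)

lemma mult_BV [simp]:
  "(f, t) \<otimes>\<^bsub>BV V\<^esub> (g, s) = (fadd f (translate V t g), t \<oplus>\<^bsub>V\<^esub> s)"
  by (simp add: BV_def fadd_def)

lemma one_BV [simp]: "\<one>\<^bsub>BV V\<^esub> = (fzero, \<zero>\<^bsub>V\<^esub>)"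
  by (simp add: BV_def)

lemma group_BV: "group (BV V)"
proof (rule groupI)
  fix g assume "g \<in> carrier (BV V)"
  then obtain f t where "g = (f, t)" "f \<in> F2_functions V" "t \<in> carrier V" by auto
  then show "\<exists>h\<in>carrier (BV V). h \<otimes>\<^bsub>BV V\<^esub> g = \<one>\<^bsub>BV V\<^esub>"
    \<comment> \<open>The inverse of \<open>(f, t)\<close> is \<open>(translate V t f, t)\<close>,
      because both \<open>f\<close> and \<open>t\<close> are their own negatives.\<close>
    by (intro bexI[of _ "(translate V t f, t)"]) simp_all
qed (auto simp: translate_fadd fadd_assoc V.M.a_assoc)

lemma card_BV: "card (carrier (BV V)) = 2 ^ card (carrier V) * card (carrier V)"
  by (simp add: card_cartesian_product card_F2_functions)

text \<open>The characters of \<open>B\<close>, indexed by \<open>B\<close> itself.\<close>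

definition lam :: "('v \<Rightarrow> bit) \<Rightarrow> ('v \<Rightarrow> bit) \<Rightarrow> complex" where
  "lam s f = bit_sign (\<Sum>x\<in>carrier V. s x * f x)"

lemma lam_commute: "lam s f = lam f s"
  by (simp add: lam_def mult.commute)

lemma lam_fadd: "lam s (fadd f g) = lam s f * lam s g"
  by (simp add: lam_def distrib_left sum.distrib flip: bit_sign_add)

lemma lam_fzero [simp]: "lam s fzero = 1" "lam fzero s = 1"
  by (simp_all add: lam_def)

lemma lam_self [simp]: "lam s f * lam s f = 1"
  using bit_sign_cases[of "\<Sum>x\<in>carrier V. s x * f x"] by (auto simp: lam_def)

text \<open>Translation is self-adjoint for the pairing of functions: substitute
  \<open>x \<oplus> t\<close> for \<open>x\<close> and use that this substitution is an
  involution.\<close>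

lemma lam_translate:
  assumes "t \<in> carrier V" "f \<in> F2_functions V"
  shows "lam s (translate V t f) = lam (translate V t s) f"
proof -
  have "bij_betw (\<lambda>x. x \<oplus>\<^bsub>V\<^esub> t) (carrier V) (carrier V)"
    using assms by (intro bij_betw_byWitness[where f' = "\<lambda>x. x \<oplus>\<^bsub>V\<^esub> t"]) auto
  then have "(\<Sum>x\<in>carrier V. s (x \<oplus>\<^bsub>V\<^esub> t) * f (x \<oplus>\<^bsub>V\<^esub> t \<oplus>\<^bsub>V\<^esub> t)) = (\<Sum>x\<in>carrier V. s x * f (x \<oplus>\<^bsub>V\<^esub> t))"
    by (rule sum.reindex_bij_betw)
  then show ?thesis using assms by (simp add: lam_def)
qed

definition fdelta :: "'v \<Rightarrow> 'v \<Rightarrow> bit" where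
  "fdelta y = (\<lambda>x \<in> carrier V. if x = y then 1 else 0)"

lemma fdelta_closed [simp]: "fdelta y \<in> F2_functions V"
  by (simp add: F2_functions_eq fdelta_def)

lemma lam_fdelta: "y \<in> carrier V \<Longrightarrow> lam s (fdelta y) = bit_sign (s y)"
  using finite_space by (simp add: lam_def fdelta_def if_distrib[of "(*) _"] sum.delta' cong: if_cong)

text \<open>If \<open>s\<close> and \<open>s'\<close> differ at \<open>y\<close>, adding the point
  mass \<open>fdelta y\<close> to \<open>f\<close> flips the sign of every summand, so the sum
  equals its own negative. If they agree, every summand is 1.\<close>

lemma lam_orthogonal:
  assumes "s \<in> F2_functions V" "s' \<in> F2_functions V"
  shows "(\<Sum>f\<in>F2_functions V. lam s f * lam s' f) = (if s = s' then of_nat (card (F2_functions V)) else 0)"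
proof (cases "s = s'")
  case False
  then obtain y where y: "y \<in> carrier V" "s y \<noteq> s' y"
    using F2_functions_eqI[OF assms] by auto
  have sign: "bit_sign (s y) * bit_sign (s' y) = -1"
    using y(2) by (auto simp: bit_sign_def)
  have "bij_betw (fadd (fdelta y)) (F2_functions V) (F2_functions V)"
    by (intro bij_betw_byWitness[where f' = "fadd (fdelta y)"]) auto
  then have "(\<Sum>f\<in>F2_functions V. lam s f * lam s' f) =
      (\<Sum>f\<in>F2_functions V. lam s (fadd (fdelta y) f) * lam s' (fadd (fdelta y) f))"
    by (rule sum.reindex_bij_betw[symmetric])
  also have "\<dots> = (\<Sum>f\<in>F2_functions V. (bit_sign (s y) * bit_sign (s' y)) * (lam s f * lam s' f))"
    by (intro sum.cong) (simp_all add: lam_fadd lam_fdelta[OF y(1)])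
  also have "\<dots> = - (\<Sum>f\<in>F2_functions V. lam s f * lam s' f)"
    by (simp add: sign sum_negf)
  finally show ?thesis using False by (simp add: eq_neg_iff_add_eq_0)
qed simp

section \<open>Translation orbits and the characters \<open>chi\<close>\<close>

definition Orb :: "('v \<Rightarrow> bit) \<Rightarrow> ('v \<Rightarrow> bit) set" where
  "Orb s = (\<lambda>t. translate V t s) ` carrier V"

lemma finite_Orb [simp]: "finite (Orb s)"
  using finite_space by (simp add: Orb_def)

lemma Orb_subset: "Orb s \<subseteq> F2_functions V"
  by (auto simp: Orb_def)

lemma Orb_self: "s \<in> F2_functions V \<Longrightarrow> s \<in> Orb s"
  by (auto simp: Orb_def intro!: image_eqI[of _ _ "\<zero>\<^bsub>V\<^esub>"])

lemma translate_Orb: "t \<in> carrier V \<Longrightarrow> T \<in> Orb s \<Longrightarrow> translate V t T \<in> Orb s"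
  by (auto simp: Orb_def)

lemma Orb_translate: 
  assumes "t \<in> carrier V" "s \<in> F2_functions V"
  shows "Orb (translate V t s) = Orb s"
proof -
  have "translate V u s \<in> Orb (translate V t s)" if "u \<in> carrier V" for u
    unfolding Orb_def using assms that
    by (intro image_eqI[of _ _ "u \<oplus>\<^bsub>V\<^esub> t"]) (simp_all add: V.M.a_assoc)
  moreover have "translate V u (translate V t s) \<in> Orb s" if "u \<in> carrier V" for u
    using assms that by (simp add: Orb_def)
  ultimately show ?thesis unfolding Orb_def by blast
qed

lemma Orb_transitive:
  assumes "T \<in> Orb s" "T' \<in> Orb s"
  obtains t where "t \<in> carrier V" "T' = translate V t T"
proof -
  from assms obtain u v where "u \<in> carrier V" "T = translate V u s" "v \<in> carrier V" "T' = translate V v s"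
    by (auto simp: Orb_def)
  then show thesis using that[of "v \<oplus>\<^bsub>V\<^esub> u"] by (simp add: V.M.a_assoc)
qed

text \<open>All points of an orbit have the same stabilizer because \<open>V\<close> is
  abelian.\<close>

lemma Orb_stabilizer:
  assumes "T \<in> Orb s" "t \<in> carrier V" "s \<in> F2_functions V"
  shows "translate V t T = T \<longleftrightarrow> translate V t s = s"
proof -
  obtain u where u: "u \<in> carrier V" "T = translate V u s"
    using assms(1) by (auto simp: Orb_def)
  have "translate V t T = translate V u (translate V t s)"
    using u assms by (simp add: V.M.a_comm)
  moreover have "translate V u (translate V u f) = f" if "f \<in> F2_functions V" for f
    using that u by simp
  ultimately show ?thesis using u assms(3) by (metis translate_closed)
qed

text \<open>These are all the linear characters of \<open>V\<close>: in an elementary abelian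
  2-group they take only the values 1 and -1.\<close>

definition sign_character :: "('v \<Rightarrow> complex) \<Rightarrow> bool" where
  "sign_character \<mu> \<longleftrightarrow>
     (\<forall>t\<in>carrier V. \<mu> t = 1 \<or> \<mu> t = -1) \<and>
     (\<forall>t\<in>carrier V. \<forall>u\<in>carrier V. \<mu> (t \<oplus>\<^bsub>V\<^esub> u) = \<mu> t * \<mu> u)"

lemma sign_character_mult:
  "sign_character \<mu> \<Longrightarrow> t \<in> carrier V \<Longrightarrow> u \<in> carrier V \<Longrightarrow> \<mu> (t \<oplus>\<^bsub>V\<^esub> u) = \<mu> t * \<mu> u"
  by (simp add: sign_character_def)

lemma sign_character_nonzero: "sign_character \<mu> \<Longrightarrow> t \<in> carrier V \<Longrightarrow> \<mu> t \<noteq> 0"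
  by (force simp: sign_character_def)

lemma sign_character_zero: "sign_character \<mu> \<Longrightarrow> \<mu> \<zero>\<^bsub>V\<^esub> = 1"
  using sign_character_mult[of \<mu> "\<zero>\<^bsub>V\<^esub>" "\<zero>\<^bsub>V\<^esub>"] sign_character_nonzero[of \<mu> "\<zero>\<^bsub>V\<^esub>"] by simp

text \<open>The character induced from the inertia group of \<open>lam s\<close>, that is,
  \<open>B\<close> extended by the stabilizer of \<open>s\<close>. It is zero outside this subgroup,
  which is normal because \<open>V\<close> is abelian.\<close>

definition chi :: "('v \<Rightarrow> bit) \<Rightarrow> ('v \<Rightarrow> complex) \<Rightarrow> ('v \<Rightarrow> bit) \<times> 'v \<Rightarrow> complex" where
  "chi s \<mu> = (\<lambda>(f, t) \<in> carrier (BV V).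
     if translate V t s = s then \<mu> t * (\<Sum>T\<in>Orb s. lam T f) else 0)"

lemma chi_apply:
  assumes "f \<in> F2_functions V" "t \<in> carrier V"
  shows "chi s \<mu> (f, t) = (if translate V t s = s then \<mu> t * (\<Sum>T\<in>Orb s. lam T f) else 0)"
  using assms by (simp add: chi_def)

text \<open>The representation induced from the extension of \<open>lam s\<close> by \<open>\<mu>\<close> to the inertia group, in
  the basis \<open>Orb s\<close>, enumerated by \<open>e\<close>.\<close>

definition monomial_rep ::
  "('v \<Rightarrow> complex) \<Rightarrow> nat \<Rightarrow> (nat \<Rightarrow> 'v \<Rightarrow> bit) \<Rightarrow> ('v \<Rightarrow> bit) \<times> 'v \<Rightarrow> complex mat" where
  "monomial_rep \<mu> m e = (\<lambda>(f, t). mat m m (\<lambda>(i, j).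
     if e i = translate V t (e j) then \<mu> t * lam (e i) f else 0))"

context
  fixes s :: "'v \<Rightarrow> bit" and \<mu> :: "'v \<Rightarrow> complex" and m :: nat and e :: "nat \<Rightarrow> 'v \<Rightarrow> bit"
  assumes s: "s \<in> F2_functions V" and mu: "sign_character \<mu>" and e: "bij_betw e {..<m} (Orb s)"
begin

lemma e_Orb: "i < m \<Longrightarrow> e i \<in> Orb s"
  using e by (auto simp: bij_betw_def)

lemma e_closed: "i < m \<Longrightarrow> e i \<in> F2_functions V"
  using e_Orb Orb_subset by blast

lemma e_eq_iff: "i < m \<Longrightarrow> j < m \<Longrightarrow> e i = e j \<longleftrightarrow> i = j"
  using e by (auto simp: bij_betw_def inj_on_def)

lemma e_translate:
  assumes "j < m" "t \<in> carrier V"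
  obtains k where "k < m" "e k = translate V t (e j)"
proof -
  have "translate V t (e j) \<in> e ` {..<m}"
    using translate_Orb[OF assms(2) e_Orb[OF assms(1)]] e by (simp add: bij_betw_def)
  then show thesis using that by auto
qed

text \<open>Each column of a monomial matrix has one nonzero entry; this collapses the sums in
  matrix products to that entry.\<close>

lemma sum_e_translate:
  fixes F :: "nat \<Rightarrow> complex"
  assumes "k < m"
  shows "(\<Sum>i<m. if e i = e k then F i else 0) = F k"
proof -
  have "(\<Sum>i<m. if e i = e k then F i else 0) = (\<Sum>i<m. if i = k then F i else 0)"
    using assms by (intro sum.cong) (auto simp: e_eq_iff)
  then show ?thesis using assms by simp
qed

lemma monomial_rep_complex_rep: "complex_rep (BV V) m (monomial_rep \<mu> m e)"
proof (rule complex_repI[OF group_BV])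
  show "monomial_rep \<mu> m e \<one>\<^bsub>BV V\<^esub> = 1\<^sub>m m"
    by (rule eq_matI) (auto simp: monomial_rep_def e_closed e_eq_iff sign_character_zero[OF mu])
next
  fix g h assume "g \<in> carrier (BV V)" "h \<in> carrier (BV V)"
  then obtain f t f' u where gh: "g = (f, t)" "h = (f', u)"
    and c: "f \<in> F2_functions V" "t \<in> carrier V" "f' \<in> F2_functions V" "u \<in> carrier V" by auto
  show "monomial_rep \<mu> m e (g \<otimes>\<^bsub>BV V\<^esub> h) = monomial_rep \<mu> m e g * monomial_rep \<mu> m e h"
  proof (rule eq_matI)
    fix i j assume "i < dim_row (monomial_rep \<mu> m e g * monomial_rep \<mu> m e h)"
      "j < dim_col (monomial_rep \<mu> m e g * monomial_rep \<mu> m e h)"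
    then have ij: "i < m" "j < m" by (simp_all add: monomial_rep_def gh)
    obtain k where k: "k < m" "e k = translate V u (e j)" using e_translate ij c by blast
    have "(monomial_rep \<mu> m e g * monomial_rep \<mu> m e h) $$ (i, j) =
        (\<Sum>l<m. if e l = e k then (if e i = translate V t (e l) then \<mu> t * lam (e i) f else 0) * (\<mu> u * lam (e l) f') else 0)"
      using ij by (auto simp: monomial_rep_def gh scalar_prod_def atLeast0LessThan k(2) intro!: sum.cong)
    also have "\<dots> = (if e i = translate V t (e k) then \<mu> t * lam (e i) f else 0) * (\<mu> u * lam (e k) f')"
      using k(1) by (rule sum_e_translate)
    \<comment> \<open>When \<open>e i\<close> is the translate of \<open>e k\<close> by
      \<open>t\<close>, moving the translation across the pairing turns \<open>lam (e i)\<close> at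
      \<open>translate V t f'\<close> into \<open>lam (e k) f'\<close>.\<close>
    also have "\<dots> = (if e i = translate V t (e k) then \<mu> (t \<oplus>\<^bsub>V\<^esub> u) * lam (e i) (fadd f (translate V t f')) else 0)"
      using c e_closed[OF k(1)] by (auto simp: lam_fadd lam_translate sign_character_mult[OF mu])
    also have "\<dots> = monomial_rep \<mu> m e (g \<otimes>\<^bsub>BV V\<^esub> h) $$ (i, j)"
      using ij c by (simp add: monomial_rep_def gh k(2))
    finally show "monomial_rep \<mu> m e (g \<otimes>\<^bsub>BV V\<^esub> h) $$ (i, j) =
        (monomial_rep \<mu> m e g * monomial_rep \<mu> m e h) $$ (i, j)" ..
  qed (simp_all add: monomial_rep_def gh)
qed (auto simp: monomial_rep_def)

lemma monomial_rep_character: "rep_character (BV V) m (monomial_rep \<mu> m e) = chi s \<mu>"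
proof (rule ext)
  fix g show "rep_character (BV V) m (monomial_rep \<mu> m e) g = chi s \<mu> g"
  proof (cases "g \<in> carrier (BV V)")
    case True
    then obtain f t where g: "g = (f, t)" "f \<in> F2_functions V" "t \<in> carrier V" by auto
    have "(\<Sum>i<m. monomial_rep \<mu> m e g $$ (i, i)) =
        (\<Sum>i<m. if translate V t s = s then \<mu> t * lam (e i) f else 0)"
    proof (rule sum.cong[OF refl])
      fix i assume "i \<in> {..<m}"
      then show "monomial_rep \<mu> m e g $$ (i, i) = (if translate V t s = s then \<mu> t * lam (e i) f else 0)"
        using Orb_stabilizer[OF e_Orb g(3) s, of i] by (auto simp: monomial_rep_def g(1))
    qed
    also have "\<dots> = (if translate V t s = s then \<mu> t * (\<Sum>i<m. lam (e i) f) else 0)"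
      by (simp add: sum_distrib_left)
    also have "(\<Sum>i<m. lam (e i) f) = (\<Sum>T\<in>Orb s. lam T f)"
      using e by (rule sum.reindex_bij_betw)
    finally show ?thesis using True g by (simp add: rep_character_def chi_apply)
  qed (auto simp: rep_character_def chi_def)
qed

text \<open>\<open>B\<close> acts diagonally with pairwise distinct characters, so an invariant
  subspace containing a nonzero vector contains a basis vector; \<open>V\<close> then moves this one
  to all the others, up to sign.\<close>

lemma monomial_rep_irreducible: "irreducible_rep (BV V) m (monomial_rep \<mu> m e)"
proof -
  have m: "0 < m" using e Orb_self[OF s] by (cases m) (auto simp: bij_betw_def)
  have "W = {0\<^sub>v m} \<or> W = carrier_vec m"
    if sub: "VectorSpace.subspace class_ring W (module_vec TYPE(complex) m)"
      and inv: "\<And>g w. g \<in> carrier (BV V) \<Longrightarrow> w \<in> W \<Longrightarrow> monomial_rep \<mu> m e g *\<^sub>v w \<in> W" for W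
  proof (cases "W = {0\<^sub>v m}")
    case False
    note W = subspace_vecD[OF sub]
    obtain w where w: "w \<in> W" "w \<noteq> 0\<^sub>v m" using False W(2) by blast
    then have wc: "w \<in> carrier_vec m" using W(1) by blast
    then obtain i where i: "i < m" "w $ i \<noteq> 0" using w(2) by (metis carrier_vecD eq_vecI index_zero_vec)
    have diag: "(monomial_rep \<mu> m e (f, \<zero>\<^bsub>V\<^esub>) *\<^sub>v w) $ j = lam (e j) f * w $ j" if j: "j < m" for f j
    proof -
      have "(monomial_rep \<mu> m e (f, \<zero>\<^bsub>V\<^esub>) *\<^sub>v w) $ j =
          (\<Sum>k<m. if e k = e j then lam (e j) f * w $ k else 0)"
        using j wc by (auto simp: monomial_rep_def scalar_prod_def atLeast0LessThan e_closed
            sign_character_zero[OF mu] intro!: sum.cong)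
      then show ?thesis by (simp add: sum_e_translate[OF j])
    qed
    \<comment> \<open>Up to the factor \<open>card (F2_functions V)\<close>, this projects
      \<open>w\<close> to the weight space of \<open>lam (e i)\<close>, the line spanned by the unit
      vector at \<open>i\<close>.\<close>
    define p where "p = vec m (\<lambda>j. \<Sum>f\<in>F2_functions V. lam (e i) f * (monomial_rep \<mu> m e (f, \<zero>\<^bsub>V\<^esub>) *\<^sub>v w) $ j)"
    have "p \<in> W" unfolding p_def
      by (rule vec_sum_in_subspace[OF W]) (auto intro!: inv w)
    define c where "c = of_nat (card (F2_functions V)) * w $ i"
    have c: "c \<noteq> 0" using i(2) by (simp add: c_def card_F2_functions)
    have "p = c \<cdot>\<^sub>v unit_vec m i"
    proof (rule eq_vecI)
      fix j assume "j < dim_vec (c \<cdot>\<^sub>v unit_vec m i)"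
      then have j: "j < m" by simp
      have "p $ j = (\<Sum>f\<in>F2_functions V. lam (e i) f * lam (e j) f) * w $ j"
        using j by (simp add: p_def diag sum_distrib_right mult.assoc)
      then show "p $ j = (c \<cdot>\<^sub>v unit_vec m i) $ j"
        using i j by (auto simp: lam_orthogonal e_closed e_eq_iff c_def)
    qed (simp add: p_def)
    then have "unit_vec m i = (1 / c) \<cdot>\<^sub>v p" using c by (simp add: smult_smult_assoc)
    then have unit_i: "unit_vec m i \<in> W" using W(4) \<open>p \<in> W\<close> by simp
    have unit: "unit_vec m k \<in> W" if k: "k < m" for k
    proof -
      obtain t where t: "t \<in> carrier V" "e k = translate V t (e i)"
        using Orb_transitive e_Orb i(1) k by metis
      let ?M = "monomial_rep \<mu> m e (fzero, t)"
      have "?M *\<^sub>v unit_vec m i = col ?M i"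
        using i(1) by (intro mult_mat_vec_unit_vec[of _ m]) (simp_all add: monomial_rep_def)
      also have "\<dots> = \<mu> t \<cdot>\<^sub>v unit_vec m k"
        using i(1) k by (intro eq_vecI) (auto simp: monomial_rep_def e_eq_iff simp flip: t(2))
      finally have "unit_vec m k = (1 / \<mu> t) \<cdot>\<^sub>v (?M *\<^sub>v unit_vec m i)"
        using sign_character_nonzero[OF mu t(1)] by (simp add: smult_smult_assoc)
      then show ?thesis using W(4) inv unit_i t(1) by simp
    qed
    have "v \<in> W" if v: "v \<in> carrier_vec m" for v
    proof -
      have "vec m (\<lambda>i. \<Sum>k\<in>{..<m}. v $ k * unit_vec m k $ i) \<in> W"
        by (rule vec_sum_in_subspace[OF W]) (auto intro!: unit)
      also have "vec m (\<lambda>i. \<Sum>k\<in>{..<m}. v $ k * unit_vec m k $ i) = v"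
        using v by (intro eq_vecI) (auto simp: unit_vec_def if_distrib[of "(*) _"] sum.delta cong: if_cong)
      finally show ?thesis .
    qed
    then show ?thesis using W(1) by blast
  qed simp
  then show ?thesis using monomial_rep_complex_rep m unfolding irreducible_rep_def by blast
qed

end

lemma Orb_enumeration: obtains m and e :: "nat \<Rightarrow> 'v \<Rightarrow> bit" where "bij_betw e {..<m} (Orb s)"
  using ex_bij_betw_nat_finite[OF finite_Orb[of s]] by (auto simp: atLeast0LessThan)

lemma chi_in_Irr: "s \<in> F2_functions V \<Longrightarrow> sign_character \<mu> \<Longrightarrow> chi s \<mu> \<in> Irr (BV V)"
  using Orb_enumeration[of s] monomial_rep_irreducible monomial_rep_character
  unfolding Irr_def by (metis (mono_tags, lifting) mem_Collect_eq)

lemma smult_vec_cancel: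
  fixes u :: "complex vec"
  assumes "u \<in> carrier_vec n" "u \<noteq> 0\<^sub>v n" "c \<cdot>\<^sub>v u = d \<cdot>\<^sub>v u"
  shows "c = d"
proof -
  obtain i where "i < n" "u $ i \<noteq> 0" using assms(1,2) by (metis carrier_vecD eq_vecI index_zero_vec)
  moreover have "(c \<cdot>\<^sub>v u) $ i = (d \<cdot>\<^sub>v u) $ i" using assms(3) by simp
  ultimately show ?thesis using assms(1) by simp
qed

text \<open>A common eigenvector \<open>u\<close> of the commuting involutions \<open>\<rho> (0, t)\<close> is projected to the weight
  spaces of \<open>B\<close>; the projections \<open>w T\<close> with \<open>T\<close> in one orbit are permuted up to scalars as the
  basis of a monomial representation.\<close>

lemma irreducible_character_eq_chi:
  assumes irr: "irreducible_rep (BV V) n \<rho>"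
  obtains s \<mu> where "s \<in> F2_functions V" "sign_character \<mu>" "rep_character (BV V) n \<rho> = chi s \<mu>"
proof -
  have rep: "complex_rep (BV V) n \<rho>" and n: "0 < n"
    using irr by (auto simp: irreducible_rep_def)
  have carr: "\<rho> (f, t) \<in> carrier_mat n n" if "f \<in> F2_functions V" "t \<in> carrier V" for f t
    using complex_rep_carrier[OF rep] that by simp
  have mult: "\<rho> (f, t) * \<rho> (g, u) = \<rho> (fadd f (translate V t g), t \<oplus>\<^bsub>V\<^esub> u)"
    if "f \<in> F2_functions V" "t \<in> carrier V" "g \<in> F2_functions V" "u \<in> carrier V" for f t g u
    using complex_rep_mult[OF rep, of "(f, t)" "(g, u)"] that by simp
  have one: "\<rho> (fzero, \<zero>\<^bsub>V\<^esub>) = 1\<^sub>m n"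
    using complex_rep_one[OF rep group_BV] by simp
  have mult_vec: "\<rho> (f, t) *\<^sub>v (\<rho> (g, u) *\<^sub>v v) = \<rho> (fadd f (translate V t g), t \<oplus>\<^bsub>V\<^esub> u) *\<^sub>v v"
    if "f \<in> F2_functions V" "t \<in> carrier V" "g \<in> F2_functions V" "u \<in> carrier V" "v \<in> carrier_vec n" for f t g u v
    using that mult[OF that(1-4)] carr by (metis assoc_mult_mat_vec)
  \<comment> \<open>The elements \<open>(fzero, t)\<close> square to the identity and commute; the
    signs by which they act on a common eigenvector form \<open>\<mu>\<close>.\<close>
  have "\<exists>u \<in> carrier_vec n. u \<noteq> 0\<^sub>v n \<and>
      (\<forall>t \<in> carrier V. \<exists>c. (c = 1 \<or> c = -1) \<and> \<rho> (fzero, t) *\<^sub>v u = c \<cdot>\<^sub>v u)"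
    by (rule common_eigenvector_involutions)
      (auto simp: finite_space n carr mult one V.M.a_comm)
  then obtain u \<mu> where u: "u \<in> carrier_vec n" "u \<noteq> 0\<^sub>v n"
    and mu: "\<And>t. t \<in> carrier V \<Longrightarrow> \<mu> t = 1 \<or> \<mu> t = -1"
      "\<And>t. t \<in> carrier V \<Longrightarrow> \<rho> (fzero, t) *\<^sub>v u = \<mu> t \<cdot>\<^sub>v u"
    by metis
  have sign: "sign_character \<mu>" unfolding sign_character_def
  proof (intro conjI ballI)
    fix t t' assume t: "t \<in> carrier V" "t' \<in> carrier V"
    have "\<mu> (t \<oplus>\<^bsub>V\<^esub> t') \<cdot>\<^sub>v u = \<rho> (fzero, t) *\<^sub>v (\<rho> (fzero, t') *\<^sub>v u)"
      using t u(1) mult_vec[of fzero t fzero t' u] mu(2)[of "t \<oplus>\<^bsub>V\<^esub> t'"] by simp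
    also have "\<dots> = (\<mu> t * \<mu> t') \<cdot>\<^sub>v u"
      using t u(1) carr[of fzero t]
      by (simp add: mu(2) mult_mat_vec[of _ n n] smult_smult_assoc mult.commute)
    finally show "\<mu> (t \<oplus>\<^bsub>V\<^esub> t') = \<mu> t * \<mu> t'" using u by (rule smult_vec_cancel[rotated 2])
  qed (rule mu(1))
  define w where "w T = vec n (\<lambda>i. \<Sum>f\<in>F2_functions V. lam T f * (\<rho> (f, \<zero>\<^bsub>V\<^esub>) *\<^sub>v u) $ i)" for T
  have w_carrier: "w T \<in> carrier_vec n" for T by (simp add: w_def)
  \<comment> \<open>The element \<open>(f, t)\<close> sends weight \<open>T\<close> to weight
    \<open>translate V t T\<close>, with the same scalar as in \<open>monomial_rep\<close>.\<close>
  have act: "(\<rho> (f, t) *\<^sub>v w T) $ i = \<mu> t * lam (translate V t T) f * w (translate V t T) $ i"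
    if f: "f \<in> F2_functions V" and t: "t \<in> carrier V" and i: "i < n" for f t T i
  proof -
    have "(\<rho> (f, t) *\<^sub>v w T) $ i =
        (\<Sum>h\<in>F2_functions V. lam T h * (\<rho> (f, t) *\<^sub>v (\<rho> (h, \<zero>\<^bsub>V\<^esub>) *\<^sub>v u)) $ i)"
      unfolding w_def using carr f t i u(1)
      by (intro mult_mat_vec_sum[of _ n n]) (auto intro!: mult_mat_vec_carrier)
    also have "\<dots> = (\<Sum>h\<in>F2_functions V. \<mu> t * lam (translate V t T) f *
        (lam (translate V t T) (fadd f (translate V t h)) * (\<rho> (fadd f (translate V t h), \<zero>\<^bsub>V\<^esub>) *\<^sub>v u) $ i))"
    proof (rule sum.cong[OF refl])
      fix h assume h: "h \<in> F2_functions V"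
      let ?k = "fadd f (translate V t h)"
      \<comment> \<open>In the group, \<open>(f, t)\<close> times \<open>(h, 0)\<close> equals
        \<open>(?k, 0)\<close> times \<open>(0, t)\<close>, and the last factor scales
        \<open>u\<close> by \<open>\<mu> t\<close>.\<close>
      have "\<rho> (f, t) *\<^sub>v (\<rho> (h, \<zero>\<^bsub>V\<^esub>) *\<^sub>v u) = \<rho> (?k, \<zero>\<^bsub>V\<^esub>) *\<^sub>v (\<rho> (fzero, t) *\<^sub>v u)"
        using f t h u(1) by (simp add: mult_vec)
      also have "\<dots> = \<mu> t \<cdot>\<^sub>v (\<rho> (?k, \<zero>\<^bsub>V\<^esub>) *\<^sub>v u)"
        using t u(1) carr[of ?k "\<zero>\<^bsub>V\<^esub>"] by (simp add: mu(2) mult_mat_vec[of _ n n])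
      finally have 1: "(\<rho> (f, t) *\<^sub>v (\<rho> (h, \<zero>\<^bsub>V\<^esub>) *\<^sub>v u)) $ i = \<mu> t * (\<rho> (?k, \<zero>\<^bsub>V\<^esub>) *\<^sub>v u) $ i"
        using i carr[of ?k "\<zero>\<^bsub>V\<^esub>"] by simp
      have 2: "lam (translate V t T) f * lam (translate V t T) ?k = lam (translate V t T) (translate V t h)"
        using lam_self[of "translate V t T" f] by (simp add: lam_fadd flip: mult.assoc)
      have 3: "lam (translate V t T) (translate V t h) = lam T h"
        using t h by (simp flip: lam_translate)
      show "lam T h * (\<rho> (f, t) *\<^sub>v (\<rho> (h, \<zero>\<^bsub>V\<^esub>) *\<^sub>v u)) $ i =
          \<mu> t * lam (translate V t T) f * (lam (translate V t T) ?k * (\<rho> (?k, \<zero>\<^bsub>V\<^esub>) *\<^sub>v u) $ i)"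
        unfolding 1 2[unfolded 3, symmetric] by (simp only: mult_ac)
    qed
    also have "\<dots> = \<mu> t * lam (translate V t T) f * (\<Sum>h\<in>F2_functions V.
        lam (translate V t T) (fadd f (translate V t h)) * (\<rho> (fadd f (translate V t h), \<zero>\<^bsub>V\<^esub>) *\<^sub>v u) $ i)"
      by (rule sum_distrib_left[symmetric])
    also have "bij_betw (\<lambda>h. fadd f (translate V t h)) (F2_functions V) (F2_functions V)"
      using t f by (intro bij_betw_byWitness[where f' = "\<lambda>k. translate V t (fadd f k)"]) (auto simp: translate_fadd)
    then have "(\<Sum>h\<in>F2_functions V.
        lam (translate V t T) (fadd f (translate V t h)) * (\<rho> (fadd f (translate V t h), \<zero>\<^bsub>V\<^esub>) *\<^sub>v u) $ i)
      = w (translate V t T) $ i"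
      unfolding w_def using i sum.reindex_bij_betw[of _ "F2_functions V" "F2_functions V"
          "\<lambda>k. lam (translate V t T) k * (\<rho> (k, \<zero>\<^bsub>V\<^esub>) *\<^sub>v u) $ i"] by simp
    finally show ?thesis .
  qed
  \<comment> \<open>Some projection is nonzero: by orthogonality all the \<open>w T\<close> add up
    to \<open>card (F2_functions V)\<close> times \<open>u\<close>.\<close>
  have "\<exists>s\<in>F2_functions V. w s \<noteq> 0\<^sub>v n"
  proof (rule ccontr)
    assume "\<not> ?thesis"
    then have w0: "w T = 0\<^sub>v n" if "T \<in> F2_functions V" for T using that by blast
    have "u $ i = 0" if i: "i < n" for i
    proof -
      have "0 = (\<Sum>T\<in>F2_functions V. w T $ i)" using i by (simp add: w0)
      also have "\<dots> = (\<Sum>T\<in>F2_functions V. \<Sum>f\<in>F2_functions V. lam T f * (\<rho> (f, \<zero>\<^bsub>V\<^esub>) *\<^sub>v u) $ i)"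
        using i by (simp add: w_def)
      also have "\<dots> = (\<Sum>f\<in>F2_functions V. (\<Sum>T\<in>F2_functions V. lam f T * lam fzero T) * (\<rho> (f, \<zero>\<^bsub>V\<^esub>) *\<^sub>v u) $ i)"
        by (subst sum.swap) (simp add: sum_distrib_right lam_commute)
      also have "\<dots> = (\<Sum>f\<in>F2_functions V. if f = fzero then of_nat (card (F2_functions V)) * u $ i else 0)"
        by (intro sum.cong) (auto simp: lam_orthogonal one u(1) simp del: lam_fzero)
      also have "\<dots> = of_nat (card (F2_functions V)) * u $ i" by simp
      finally show ?thesis by (simp add: card_F2_functions)
    qed
    then show False using u by (metis carrier_vecD eq_vecI index_zero_vec)
  qed
  then obtain s where s: "s \<in> F2_functions V" "w s \<noteq> 0\<^sub>v n" by blast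
  obtain m :: nat and e where e: "bij_betw e {..<m} (Orb s)"
    by (rule Orb_enumeration)
  note e_facts = e_closed[OF s(1) sign e] sum_e_translate[OF s(1) sign e]
  \<comment> \<open>\<open>P\<close> sends the basis vectors of the monomial representation to the
    projections \<open>w (e j)\<close>. It intertwines by \<open>act\<close> and is nonzero because
    \<open>s\<close> occurs among the \<open>e j\<close>.\<close>
  define P where "P = mat n m (\<lambda>(i, j). w (e j) $ i)"
  have P: "P \<in> carrier_mat n m" by (simp add: P_def)
  have colP: "col P j = w (e j)" if "j < m" for j
    using that by (intro eq_vecI) (simp_all add: P_def w_def)
  have "P \<noteq> 0\<^sub>m n m"
  proof
    assume "P = 0\<^sub>m n m"
    moreover have "s \<in> e ` {..<m}" using e Orb_self[OF s(1)] by (simp add: bij_betw_def)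
    then obtain j where "j < m" "e j = s" by auto
    ultimately show False using s(2) colP[of j] by simp
  qed
  moreover have "\<rho> g * P = P * monomial_rep \<mu> m e g" if "g \<in> carrier (BV V)" for g
  proof -
    obtain f t where g: "g = (f, t)" "f \<in> F2_functions V" "t \<in> carrier V" using \<open>g \<in> carrier (BV V)\<close> by auto
    show ?thesis
    proof (rule eq_matI)
      fix i j assume "i < dim_row (P * monomial_rep \<mu> m e g)" "j < dim_col (P * monomial_rep \<mu> m e g)"
      then have ij: "i < n" "j < m" by (simp_all add: P_def monomial_rep_def g)
      obtain k where k: "k < m" "e k = translate V t (e j)"
        using e_translate[OF s(1) sign e ij(2) g(3)] by blast
      have "(P * monomial_rep \<mu> m e g) $$ (i, j) =
          (\<Sum>l<m. if e l = e k then w (e l) $ i * (\<mu> t * lam (e l) f) else 0)"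
        using ij by (auto simp: P_def monomial_rep_def g(1) scalar_prod_def atLeast0LessThan k(2) intro!: sum.cong)
      also have "\<dots> = w (e k) $ i * (\<mu> t * lam (e k) f)" by (rule e_facts(2)[OF k(1)])
      also have "\<dots> = (\<rho> g *\<^sub>v w (e j)) $ i"
        using act[OF g(2,3) ij(1), of "e j"] by (simp add: g(1) k(2))
      also have "\<dots> = (\<rho> g * P) $$ (i, j)"
        using ij carr[OF g(2,3)] P by (simp add: g(1) flip: colP)
      finally show "(\<rho> g * P) $$ (i, j) = (P * monomial_rep \<mu> m e g) $$ (i, j)" ..
    qed (use P carr[OF g(2,3)] in \<open>simp_all add: g monomial_rep_def\<close>)
  qed
  ultimately have "rep_character (BV V) n \<rho> = rep_character (BV V) m (monomial_rep \<mu> m e)"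
    using irr monomial_rep_irreducible[OF s(1) sign e] P by (intro irreducible_intertwiner_character)
  then show thesis
    using that s(1) sign monomial_rep_character[OF s(1) sign e] by simp
qed

text \<open>The parametrization is not injective: \<open>s\<close> may move in its orbit, and only
  the values of \<open>\<mu>\<close> on the stabilizer of \<open>s\<close> are seen.\<close>

theorem Irr_BV: "Irr (BV V) = {chi s \<mu> | s \<mu>. s \<in> F2_functions V \<and> sign_character \<mu>}"
proof
  show "Irr (BV V) \<subseteq> {chi s \<mu> | s \<mu>. s \<in> F2_functions V \<and> sign_character \<mu>}"
    unfolding Irr_def using irreducible_character_eq_chi by blast
qed (auto intro: chi_in_Irr)

end

section \<open>Invariant characters\<close>

lemma (in abelian_group) finsum_in_closed:
  assumes "\<zero> \<in> H" "\<And>x y. x \<in> H \<Longrightarrow> y \<in> H \<Longrightarrow> x \<oplus> y \<in> H" "H \<subseteq> carrier G"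
    and "finite F" "\<And>i. i \<in> F \<Longrightarrow> f i \<in> H"
  shows "finsum G f F \<in> H"
  using assms(4,5)
proof (induction F)
  case (insert i F)
  then have "f \<in> F \<rightarrow> carrier G" "f i \<in> carrier G" using assms(3) by auto
  then show ?case using insert assms(2) by (simp add: finsum_insert)
qed (simp add: assms(1))

text \<open>The derived subgroup of a commutative group is trivial, and by Lagrange the trivial
  subgroup has as many cosets as there are elements.\<close>

lemma (in comm_group) order_abelianization:
  assumes "finite (carrier G)"
  shows "Coset.order (G Mod derived G (carrier G)) = card (carrier G)"
proof -
  have "card (rcosets {\<one>}) * card {\<one>} = Coset.order G"
    using lagrange[OF triv_subgroup] .
  then show ?thesis
    by (simp add: derived_eq_singleton Coset.order_def FactGroup_def)
qed

locale odd_F2_module = finite_F2_module A V \<phi>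
  for A :: "('a, 'm) monoid_scheme" and V :: "(bit, 'v) module" and \<phi> +
  assumes finite_A: "finite (carrier A)"
    and odd_A: "odd (Coset.order A)"
    and no_fixed: "no_fixed_vector A V \<phi>"
begin

sublocale finite_F2_space V
  by unfold_locales (rule finite_carrier)

lemma act_inv [simp]:
  "a \<in> carrier A \<Longrightarrow> x \<in> carrier V \<Longrightarrow> \<phi> (inv\<^bsub>A\<^esub> a) (\<phi> a x) = x"
  "a \<in> carrier A \<Longrightarrow> x \<in> carrier V \<Longrightarrow> \<phi> a (\<phi> (inv\<^bsub>A\<^esub> a) x) = x"
  by (simp_all flip: act_mult)

lemma act_finsum:
  assumes "a \<in> carrier A" "finite F" "f \<in> F \<rightarrow> carrier V"
  shows "\<phi> a (finsum V f F) = finsum V (\<lambda>i. \<phi> a (f i)) F"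
  using assms(2,3)
proof (induction F)
  case (insert i F)
  then have "f i \<in> carrier V" "f \<in> F \<rightarrow> carrier V" by auto
  moreover from this have "(\<lambda>i. \<phi> a (f i)) \<in> F \<rightarrow> carrier V" using assms(1) by (auto simp: Pi_iff)
  ultimately show ?case using insert assms(1) by (simp add: act_add)
qed (simp add: assms(1))

section \<open>Averaging over the odd group \<open>A\<close>\<close>

lemma finsum_shift:
  assumes "b \<in> carrier A" "f \<in> carrier A \<rightarrow> carrier V"
  shows "finsum V (\<lambda>a. f (b \<otimes>\<^bsub>A\<^esub> a)) (carrier A) = finsum V f (carrier A)"
proof -
  have "(\<lambda>a. b \<otimes>\<^bsub>A\<^esub> a) ` carrier A = carrier A" "inj_on (\<lambda>a. b \<otimes>\<^bsub>A\<^esub> a) (carrier A)"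
    using assms(1) A.surj_const_mult A.inj_on_cmult by auto
  then show ?thesis
    using V.M.finsum_reindex[of f "\<lambda>a. b \<otimes>\<^bsub>A\<^esub> a" "carrier A"] assms(2) by simp
qed

text \<open>An odd number of copies of \<open>t\<close> adds up to \<open>t\<close> in
  characteristic 2, so summation over \<open>A\<close> is averaging without division.\<close>

lemma finsum_const:
  assumes "t \<in> carrier V"
  shows "finsum V (\<lambda>_. t) (carrier A) = t"
proof -
  have "finite F \<Longrightarrow> finsum V (\<lambda>_. t) F = (if odd (card F) then t else \<zero>\<^bsub>V\<^esub>)" for F :: "'a set"
    by (induction F rule: finite_induct) (use assms in auto)
  then show ?thesis using finite_A odd_A by (simp add: Coset.order_def)
qed

text \<open>The sum is fixed by \<open>A\<close>, since multiplication by \<open>b\<close> permutes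
  its terms.\<close>

lemma finsum_act_eq_zero:
  assumes t: "t \<in> carrier V"
  shows "finsum V (\<lambda>a. \<phi> a t) (carrier A) = \<zero>\<^bsub>V\<^esub>"
proof -
  have "\<phi> b (finsum V (\<lambda>a. \<phi> a t) (carrier A)) = finsum V (\<lambda>a. \<phi> a t) (carrier A)"
    if b: "b \<in> carrier A" for b
  proof -
    have "\<phi> b (finsum V (\<lambda>a. \<phi> a t) (carrier A)) = finsum V (\<lambda>a. \<phi> b (\<phi> a t)) (carrier A)"
      using b finite_A t by (simp add: act_finsum)
    also have "\<dots> = finsum V (\<lambda>a. \<phi> (b \<otimes>\<^bsub>A\<^esub> a) t) (carrier A)"
      using b t by (intro V.M.finsum_cong') (auto simp: act_mult)
    also have "\<dots> = finsum V (\<lambda>a. \<phi> a t) (carrier A)"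
      using b t by (intro finsum_shift) auto
    finally show ?thesis .
  qed
  then have "finsum V (\<lambda>a. \<phi> a t) (carrier A) \<in> fixed_points A \<phi> (carrier V)"
    using t by (auto simp: fixed_points_def)
  then show ?thesis using no_fixed by (simp add: no_fixed_vector_def)
qed

text \<open>Fixed points of \<open>A\<close> on \<open>V / H\<close> vanish.\<close>

lemma fixed_modulo:
  assumes H: "\<zero>\<^bsub>V\<^esub> \<in> H" "\<And>x y. x \<in> H \<Longrightarrow> y \<in> H \<Longrightarrow> x \<oplus>\<^bsub>V\<^esub> y \<in> H" "H \<subseteq> carrier V"
    and t: "t \<in> carrier V" and fixed: "\<And>a. a \<in> carrier A \<Longrightarrow> \<phi> a t \<oplus>\<^bsub>V\<^esub> t \<in> H"
  shows "t \<in> H"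
proof -
  \<comment> \<open>Sum the hypothesis over \<open>A\<close>: the terms \<open>\<phi> a t\<close>
    cancel, and the constant terms leave \<open>t\<close>.\<close>
  have "finsum V (\<lambda>a. \<phi> a t \<oplus>\<^bsub>V\<^esub> t) (carrier A) \<in> H"
    using H finite_A fixed by (rule V.M.finsum_in_closed)
  also have "finsum V (\<lambda>a. \<phi> a t \<oplus>\<^bsub>V\<^esub> t) (carrier A) = t"
    using t by (simp add: V.M.finsum_addf finsum_act_eq_zero finsum_const)
  finally show ?thesis .
qed

text \<open>The first cohomology of \<open>A\<close> with coefficients in \<open>V / H\<close> vanishes, because \<open>|A|\<close> is odd.\<close>

lemma cocycle_modulo:
  assumes H: "\<zero>\<^bsub>V\<^esub> \<in> H" "\<And>x y. x \<in> H \<Longrightarrow> y \<in> H \<Longrightarrow> x \<oplus>\<^bsub>V\<^esub> y \<in> H" "H \<subseteq> carrier V"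
    and c: "\<And>a. a \<in> carrier A \<Longrightarrow> c a \<in> carrier V"
    and cocycle: "\<And>a b. a \<in> carrier A \<Longrightarrow> b \<in> carrier A \<Longrightarrow>
      c (a \<otimes>\<^bsub>A\<^esub> b) \<oplus>\<^bsub>V\<^esub> (\<phi> a (c b) \<oplus>\<^bsub>V\<^esub> c a) \<in> H"
  obtains t where "t \<in> carrier V" "\<And>a. a \<in> carrier A \<Longrightarrow> t \<oplus>\<^bsub>V\<^esub> (\<phi> a t \<oplus>\<^bsub>V\<^esub> c a) \<in> H"
proof
  have cf: "c \<in> carrier A \<rightarrow> carrier V" using c by auto
  let ?t = "finsum V c (carrier A)"
  show "?t \<in> carrier V" using cf by (rule V.M.finsum_closed)
  fix a assume a: "a \<in> carrier A"
  \<comment> \<open>Summing the cocycle relation over \<open>b\<close> shows that the sum of all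
    values of \<open>c\<close> is the required witness.\<close>
  have "finsum V (\<lambda>b. c (a \<otimes>\<^bsub>A\<^esub> b) \<oplus>\<^bsub>V\<^esub> (\<phi> a (c b) \<oplus>\<^bsub>V\<^esub> c a)) (carrier A) \<in> H"
    using H finite_A cocycle[OF a] by (rule V.M.finsum_in_closed)
  also have "finsum V (\<lambda>b. c (a \<otimes>\<^bsub>A\<^esub> b) \<oplus>\<^bsub>V\<^esub> (\<phi> a (c b) \<oplus>\<^bsub>V\<^esub> c a)) (carrier A) =
      finsum V (\<lambda>b. c (a \<otimes>\<^bsub>A\<^esub> b)) (carrier A) \<oplus>\<^bsub>V\<^esub>
        (finsum V (\<lambda>b. \<phi> a (c b)) (carrier A) \<oplus>\<^bsub>V\<^esub> finsum V (\<lambda>_. c a) (carrier A))"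
    using a c by (subst V.M.finsum_addf; (subst V.M.finsum_addf)?) auto
  also have "\<dots> = ?t \<oplus>\<^bsub>V\<^esub> (\<phi> a ?t \<oplus>\<^bsub>V\<^esub> c a)"
    using a c cf finite_A by (simp add: finsum_shift finsum_const act_finsum)
  finally show "?t \<oplus>\<^bsub>V\<^esub> (\<phi> a ?t \<oplus>\<^bsub>V\<^esub> c a) \<in> H" .
qed

section \<open>The action on functions and the fixed subgroup\<close>

definition act_fun :: "'a \<Rightarrow> ('v \<Rightarrow> bit) \<Rightarrow> 'v \<Rightarrow> bit" where
  "act_fun a f = compose (carrier V) f (\<phi> (inv\<^bsub>A\<^esub> a))"

lemma act_fun_closed [simp]: "act_fun a f \<in> F2_functions V"
  by (simp add: F2_functions_eq act_fun_def)

lemma act_fun_apply: "x \<in> carrier V \<Longrightarrow> act_fun a f x = f (\<phi> (inv\<^bsub>A\<^esub> a) x)"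
  by (simp add: act_fun_def compose_eq)

lemma BV_action_apply:
  "f \<in> F2_functions V \<Longrightarrow> t \<in> carrier V \<Longrightarrow> BV_action A V \<phi> a (f, t) = (act_fun a f, \<phi> a t)"
  by (simp add: BV_action_def act_fun_def)

lemma act_fun_mult:
  "a \<in> carrier A \<Longrightarrow> b \<in> carrier A \<Longrightarrow> act_fun (a \<otimes>\<^bsub>A\<^esub> b) f = act_fun a (act_fun b f)"
  by (rule F2_functions_eqI) (simp_all add: act_fun_apply A.inv_mult_group act_mult)

lemma act_fun_inv [simp]:
  assumes "a \<in> carrier A" "f \<in> F2_functions V"
  shows "act_fun (inv\<^bsub>A\<^esub> a) (act_fun a f) = f" "act_fun a (act_fun (inv\<^bsub>A\<^esub> a) f) = f"
  using assms by (auto intro!: F2_functions_eqI simp: act_fun_apply)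

lemma act_fun_fzero [simp]: "a \<in> carrier A \<Longrightarrow> act_fun a fzero = fzero"
  by (rule F2_functions_eqI) (simp_all add: act_fun_apply)

lemma act_fun_fadd: "a \<in> carrier A \<Longrightarrow> act_fun a (fadd f g) = fadd (act_fun a f) (act_fun a g)"
  by (rule F2_functions_eqI) (simp_all add: act_fun_apply)

lemma act_fun_translate:
  "a \<in> carrier A \<Longrightarrow> t \<in> carrier V \<Longrightarrow> act_fun a (translate V t f) = translate V (\<phi> a t) (act_fun a f)"
  by (rule F2_functions_eqI) (simp_all add: act_fun_apply act_add)

lemma bij_act_fun: "a \<in> carrier A \<Longrightarrow> bij_betw (act_fun a) (F2_functions V) (F2_functions V)"
  by (intro bij_betw_byWitness[where f' = "act_fun (inv\<^bsub>A\<^esub> a)"]) auto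

lemma lam_act_fun:
  assumes "a \<in> carrier A"
  shows "lam (act_fun a s) (act_fun a f) = lam s f"
proof -
  have "bij_betw (\<phi> (inv\<^bsub>A\<^esub> a)) (carrier V) (carrier V)"
    using assms by (intro bij_betw_byWitness[where f' = "\<phi> a"]) auto
  then have "(\<Sum>x\<in>carrier V. s (\<phi> (inv\<^bsub>A\<^esub> a) x) * f (\<phi> (inv\<^bsub>A\<^esub> a) x)) = (\<Sum>x\<in>carrier V. s x * f x)"
    by (rule sum.reindex_bij_betw)
  then show ?thesis by (simp add: lam_def act_fun_apply)
qed

definition invariant_functions :: "('v \<Rightarrow> bit) set" where
  "invariant_functions = {s \<in> F2_functions V. \<forall>a\<in>carrier A. act_fun a s = s}"

lemma finite_invariant_functions: "finite invariant_functions"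
  by (simp add: invariant_functions_def)

text \<open>A fixed pair has a fixed second component, which is zero. So the fixed subgroup lies in
  \<open>B\<close>, and the invariant functions count it.\<close>

lemma fixed_points_BV:
  "fixed_points A (BV_action A V \<phi>) (carrier (BV V)) = invariant_functions \<times> {\<zero>\<^bsub>V\<^esub>}"
proof -
  have fixed: "(\<forall>a\<in>carrier A. \<phi> a t = t) \<longleftrightarrow> t = \<zero>\<^bsub>V\<^esub>" if "t \<in> carrier V" for t
    using no_fixed that unfolding no_fixed_vector_def fixed_points_def by blast
  have "(f, t) \<in> fixed_points A (BV_action A V \<phi>) (carrier (BV V)) \<longleftrightarrow>
      (f, t) \<in> invariant_functions \<times> {\<zero>\<^bsub>V\<^esub>}" for f t
    using fixed[of t]
    by (cases "f \<in> F2_functions V"; cases "t \<in> carrier V")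
      (auto simp: fixed_points_def invariant_functions_def BV_action_apply)
  then show ?thesis by auto
qed

lemma carrier_fixed_subgroup:
  "carrier (fixed_subgroup A (BV_action A V \<phi>) (BV V)) = invariant_functions \<times> {\<zero>\<^bsub>V\<^esub>}"
  by (simp only: fixed_subgroup_def fixed_points_BV) simp

lemma comm_group_fixed_subgroup: "comm_group (fixed_subgroup A (BV_action A V \<phi>) (BV V))"
  unfolding fixed_subgroup_def fixed_points_BV
proof (rule comm_groupI)
  fix x assume "x \<in> carrier (BV V\<lparr>carrier := invariant_functions \<times> {\<zero>\<^bsub>V\<^esub>}\<rparr>)"
  then obtain f where "x = (f, \<zero>\<^bsub>V\<^esub>)" "f \<in> invariant_functions" by auto
  then show "\<exists>y\<in>carrier (BV V\<lparr>carrier := invariant_functions \<times> {\<zero>\<^bsub>V\<^esub>}\<rparr>).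
      y \<otimes>\<^bsub>BV V\<lparr>carrier := invariant_functions \<times> {\<zero>\<^bsub>V\<^esub>}\<rparr>\<^esub> x =
      \<one>\<^bsub>BV V\<lparr>carrier := invariant_functions \<times> {\<zero>\<^bsub>V\<^esub>}\<rparr>\<^esub>"
    by (intro bexI[of _ x]) (auto simp: invariant_functions_def)
qed (auto simp: invariant_functions_def fadd_assoc act_fun_fadd intro: fadd_commute)

lemma elementary_abelian_fixed_subgroup:
  "elementary_abelian (fixed_subgroup A (BV_action A V \<phi>) (BV V))"
  unfolding elementary_abelian_def
proof (intro conjI exI ballI)
  let ?C = "fixed_subgroup A (BV_action A V \<phi>) (BV V)"
  show "comm_group ?C" by (rule comm_group_fixed_subgroup)
  then interpret C: comm_group ?C .
  show "prime (2 :: nat)" by (rule two_is_prime_nat)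
  fix x assume x: "x \<in> carrier ?C"
  then have "x \<otimes>\<^bsub>?C\<^esub> x = \<one>\<^bsub>?C\<^esub>"
    unfolding carrier_fixed_subgroup by (auto simp: fixed_subgroup_def invariant_functions_def)
  then show "x [^]\<^bsub>?C\<^esub> (2 :: nat) = \<one>\<^bsub>?C\<^esub>"
    using x by (simp add: numeral_2_eq_2)
qed

lemma order_abelianization_fixed_subgroup:
  "Coset.order (abelianization (fixed_subgroup A (BV_action A V \<phi>) (BV V))) = card invariant_functions"
proof -
  let ?C = "fixed_subgroup A (BV_action A V \<phi>) (BV V)"
  interpret C: comm_group ?C by (rule comm_group_fixed_subgroup)
  show ?thesis
    using C.order_abelianization carrier_fixed_subgroup
    by (simp add: abelianization_def finite_invariant_functions card_cartesian_product)
qed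

section \<open>Which characters are invariant\<close>

text \<open>Up to the factor \<open>card (F2_functions V)\<close>, the sum is the multiplicity of
  \<open>lam T\<close> in the restriction to \<open>B\<close>; no conjugation appears as
  \<open>lam\<close> is real. Thus the character determines the orbit of \<open>s\<close>.\<close>

lemma chi_weight:
  assumes "T \<in> F2_functions V" "s \<in> F2_functions V" "sign_character \<mu>"
  shows "(\<Sum>f\<in>F2_functions V. lam T f * chi s \<mu> (f, \<zero>\<^bsub>V\<^esub>)) =
    (if T \<in> Orb s then of_nat (card (F2_functions V)) else 0)"
proof -
  have "(\<Sum>f\<in>F2_functions V. lam T f * chi s \<mu> (f, \<zero>\<^bsub>V\<^esub>)) =
      (\<Sum>f\<in>F2_functions V. \<Sum>T'\<in>Orb s. lam T f * lam T' f)"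
    using assms by (intro sum.cong) (auto simp: chi_apply sign_character_zero sum_distrib_left)
  also have "\<dots> = (\<Sum>T'\<in>Orb s. \<Sum>f\<in>F2_functions V. lam T f * lam T' f)"
    by (rule sum.swap)
  also have "\<dots> = (\<Sum>T'\<in>Orb s. if T = T' then of_nat (card (F2_functions V)) else 0)"
    using assms(1) Orb_subset by (intro sum.cong refl lam_orthogonal) auto
  also have "\<dots> = (if T \<in> Orb s then of_nat (card (F2_functions V)) else 0)"
    by simp
  finally show ?thesis .
qed

lemma translate_eq_iff:
  assumes "x \<in> carrier V" "y \<in> carrier V" "s \<in> F2_functions V"
  shows "translate V x s = translate V y s \<longleftrightarrow> translate V (x \<oplus>\<^bsub>V\<^esub> y) s = s"
proof
  assume "translate V x s = translate V y s"
  then have "translate V x (translate V x s) = translate V x (translate V y s)" by simp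
  then show "translate V (x \<oplus>\<^bsub>V\<^esub> y) s = s" using assms by simp
next
  assume "translate V (x \<oplus>\<^bsub>V\<^esub> y) s = s"
  then have "translate V y (translate V (x \<oplus>\<^bsub>V\<^esub> y) s) = translate V y s" by simp
  moreover have "y \<oplus>\<^bsub>V\<^esub> (x \<oplus>\<^bsub>V\<^esub> y) = x"
    using assms(1,2) by (metis V.M.a_comm V.M.add.m_closed add_add_self)
  ultimately show "translate V x s = translate V y s" using assms by simp
qed

lemma stabilizer_closed:
  assumes "s \<in> F2_functions V"
  shows "\<zero>\<^bsub>V\<^esub> \<in> {t \<in> carrier V. translate V t s = s}"
    "x \<in> {t \<in> carrier V. translate V t s = s} \<Longrightarrow> y \<in> {t \<in> carrier V. translate V t s = s} \<Longrightarrow>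
      x \<oplus>\<^bsub>V\<^esub> y \<in> {t \<in> carrier V. translate V t s = s}"
  using assms by (auto simp flip: translate_translate)

lemma chi_translate:
  assumes "s \<in> F2_functions V" "t \<in> carrier V"
  shows "chi (translate V t s) \<mu> = chi s \<mu>"
proof -
  have "translate V t s \<in> Orb s" using assms by (simp add: Orb_def)
  from Orb_stabilizer[OF this] show ?thesis unfolding chi_def
    using assms by (auto simp: Orb_translate simp del: translate_translate intro!: restrict_ext)
qed

abbreviation one_character :: "'v \<Rightarrow> complex" where
  "one_character \<equiv> \<lambda>_. 1"

lemma sign_character_one [simp]: "sign_character one_character"
  by (simp add: sign_character_def)

text \<open>In an invariant character, \<open>lam (act_fun a s)\<close> occurs in the restriction to
  \<open>B\<close> as often as \<open>lam s\<close>, hence it occurs.\<close>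

lemma act_fun_in_Orb:
  assumes s: "s \<in> F2_functions V" and mu: "sign_character \<mu>" and a: "a \<in> carrier A"
    and inv: "\<And>g. g \<in> carrier (BV V) \<Longrightarrow> chi s \<mu> (BV_action A V \<phi> a g) = chi s \<mu> g"
  shows "act_fun a s \<in> Orb s"
proof -
  have "(\<Sum>f\<in>F2_functions V. lam (act_fun a s) f * chi s \<mu> (f, \<zero>\<^bsub>V\<^esub>)) =
      (\<Sum>f\<in>F2_functions V. lam (act_fun a s) (act_fun a f) * chi s \<mu> (act_fun a f, \<zero>\<^bsub>V\<^esub>))"
    by (rule sum.reindex_bij_betw[OF bij_act_fun[OF a], symmetric])
  also have "\<dots> = (\<Sum>f\<in>F2_functions V. lam s f * chi s \<mu> (f, \<zero>\<^bsub>V\<^esub>))"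
  proof (rule sum.cong[OF refl])
    fix f assume "f \<in> F2_functions V"
    then show "lam (act_fun a s) (act_fun a f) * chi s \<mu> (act_fun a f, \<zero>\<^bsub>V\<^esub>) = lam s f * chi s \<mu> (f, \<zero>\<^bsub>V\<^esub>)"
      using inv[of "(f, \<zero>\<^bsub>V\<^esub>)"] a by (simp add: lam_act_fun BV_action_apply)
  qed
  finally show ?thesis
    using chi_weight[OF _ s mu, of "act_fun a s"] chi_weight[OF s s mu] Orb_self[OF s]
    by (auto simp: card_F2_functions split: if_splits)
qed

text \<open>Glauberman's lemma for \<open>A\<close> acting on the orbit of \<open>s\<close> under translations.\<close>

lemma invariant_translate_exists:
  assumes s: "s \<in> F2_functions V" and orb: "\<And>a. a \<in> carrier A \<Longrightarrow> act_fun a s \<in> Orb s"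
  obtains t where "t \<in> carrier V" "translate V t s \<in> invariant_functions"
proof -
  have "\<forall>a\<in>carrier A. \<exists>c. c \<in> carrier V \<and> act_fun a s = translate V c s"
    using orb by (auto simp: Orb_def)
  \<comment> \<open>The vector \<open>c a\<close> is determined only modulo the stabilizer of
    \<open>s\<close>, so \<open>c\<close> satisfies the cocycle relation modulo
    \<open>?H\<close>.\<close>
  then obtain c where c: "\<And>a. a \<in> carrier A \<Longrightarrow> c a \<in> carrier V"
    "\<And>a. a \<in> carrier A \<Longrightarrow> act_fun a s = translate V (c a) s"
    by metis
  let ?H = "{t \<in> carrier V. translate V t s = s}"
  obtain t where t: "t \<in> carrier V" "\<And>a. a \<in> carrier A \<Longrightarrow> t \<oplus>\<^bsub>V\<^esub> (\<phi> a t \<oplus>\<^bsub>V\<^esub> c a) \<in> ?H"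
  proof (rule cocycle_modulo[of ?H c])
    fix a b assume ab: "a \<in> carrier A" "b \<in> carrier A"
    have "translate V (c (a \<otimes>\<^bsub>A\<^esub> b)) s = act_fun a (act_fun b s)"
      using ab by (simp add: act_fun_mult flip: c(2))
    also have "\<dots> = translate V (\<phi> a (c b) \<oplus>\<^bsub>V\<^esub> c a) s"
      using ab c(1) by (simp add: c(2) act_fun_translate)
    finally show "c (a \<otimes>\<^bsub>A\<^esub> b) \<oplus>\<^bsub>V\<^esub> (\<phi> a (c b) \<oplus>\<^bsub>V\<^esub> c a) \<in> ?H"
      using ab c(1) s by (simp add: translate_eq_iff)
  qed (use c(1) stabilizer_closed[OF s] in auto)
  have "act_fun a (translate V t s) = translate V t s" if a: "a \<in> carrier A" for a
  proof -
    have "act_fun a (translate V t s) = translate V (\<phi> a t \<oplus>\<^bsub>V\<^esub> c a) s"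
      using a t(1) c by (simp add: act_fun_translate)
    also have "\<dots> = translate V t s"
      using t(2)[OF a] translate_eq_iff[OF t(1) _ s, of "\<phi> a t \<oplus>\<^bsub>V\<^esub> c a"] a t(1) c(1) by simp
    finally show ?thesis .
  qed
  then show thesis using that t(1) by (simp add: invariant_functions_def)
qed

text \<open>If both functions are invariant, the class of \<open>t\<close> modulo the stabilizer of
  \<open>s\<close> is fixed by \<open>A\<close>, so it is zero.\<close>

lemma invariant_functions_orbit_unique:
  assumes "s \<in> invariant_functions" "t \<in> carrier V" "translate V t s \<in> invariant_functions"
  shows "translate V t s = s"
proof -
  have s: "s \<in> F2_functions V" using assms by (simp add: invariant_functions_def)
  have "t \<in> {t \<in> carrier V. translate V t s = s}"
  proof (rule fixed_modulo)
    fix a assume a: "a \<in> carrier A"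
    have "translate V (\<phi> a t) s = translate V t s"
      using assms a act_fun_translate[of a t s] by (simp add: invariant_functions_def)
    then show "\<phi> a t \<oplus>\<^bsub>V\<^esub> t \<in> {t \<in> carrier V. translate V t s = s}"
      using a assms(2) s by (simp add: translate_eq_iff)
  qed (use assms(2) stabilizer_closed[OF s] in auto)
  then show ?thesis by simp
qed

text \<open>On the stabilizer of \<open>s\<close>, invariance of the character makes
  \<open>\<mu>\<close> invariant, so its kernel \<open>?H\<close> there contains every
  \<open>\<phi> a t \<oplus> t\<close>. By \<open>fixed_modulo\<close> it contains
  \<open>t\<close>.\<close>

lemma chi_invariant_eq_chi_one:
  assumes s: "s \<in> invariant_functions" and mu: "sign_character \<mu>"
    and inv: "\<And>a g. a \<in> carrier A \<Longrightarrow> g \<in> carrier (BV V) \<Longrightarrow> chi s \<mu> (BV_action A V \<phi> a g) = chi s \<mu> g"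
  shows "chi s \<mu> = chi s one_character"
proof -
  have sF: "s \<in> F2_functions V" using s by (simp add: invariant_functions_def)
  \<comment> \<open>This sum is the size of the orbit; cancelling it isolates the values of
    \<open>\<mu>\<close> at the elements \<open>(fzero, t)\<close>.\<close>
  have orb: "(\<Sum>T\<in>Orb s. lam T fzero) \<noteq> 0"
    using Orb_self[OF sF] by (auto simp: card_eq_0_iff)
  let ?H = "{t \<in> carrier V. translate V t s = s \<and> \<mu> t = 1}"
  have "\<mu> t = 1" if t: "t \<in> carrier V" "translate V t s = s" for t
  proof -
    have "t \<in> ?H"
    proof (rule fixed_modulo)
      fix a assume a: "a \<in> carrier A"
      have at: "translate V (\<phi> a t) s = s"
        using act_fun_translate[OF a t(1), of s] s t(2) a by (simp add: invariant_functions_def)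
      have "\<mu> (\<phi> a t) = \<mu> t"
        using inv[OF a, of "(fzero, t)"] a t at orb by (simp add: BV_action_apply chi_apply)
      moreover have "\<mu> t * \<mu> t = 1" using mu t(1) by (auto simp: sign_character_def)
      ultimately show "\<phi> a t \<oplus>\<^bsub>V\<^esub> t \<in> ?H"
        using a t at by (simp add: sign_character_mult[OF mu] flip: translate_translate)
    next
      show "\<zero>\<^bsub>V\<^esub> \<in> ?H" using sF by (simp add: sign_character_zero[OF mu])
    next
      show "x \<oplus>\<^bsub>V\<^esub> y \<in> ?H" if "x \<in> ?H" "y \<in> ?H" for x y
        using that by (simp add: sign_character_mult[OF mu] flip: translate_translate)
    qed (use t in auto)
    then show ?thesis by simp
  qed
  then show ?thesis unfolding chi_def by (auto intro!: restrict_ext)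
qed

text \<open>For invariant \<open>s\<close>, the action of \<open>A\<close> preserves the stabilizer
  of \<open>s\<close> and permutes its orbit.\<close>

lemma chi_one_invariant:
  assumes s: "s \<in> invariant_functions" and a: "a \<in> carrier A" and g: "g \<in> carrier (BV V)"
  shows "chi s one_character (BV_action A V \<phi> a g) = chi s one_character g"
proof -
  obtain f t where g: "g = (f, t)" "f \<in> F2_functions V" "t \<in> carrier V" using g by auto
  have sF: "s \<in> F2_functions V" and as: "act_fun a s = s"
    using s a by (simp_all add: invariant_functions_def)
  have "translate V (\<phi> a t) s = act_fun a (translate V t s)"
    using act_fun_translate[OF a g(3), of s] as by simp
  then have stab: "translate V (\<phi> a t) s = s \<longleftrightarrow> translate V t s = s"
    using as a by (metis act_fun_inv(1) translate_closed)
  have "act_fun a T \<in> Orb s" if "T \<in> Orb s" for T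
    using that a as by (auto simp: Orb_def act_fun_translate)
  moreover have "act_fun (inv\<^bsub>A\<^esub> a) T \<in> Orb s" if "T \<in> Orb s" for T
  proof -
    have "act_fun (inv\<^bsub>A\<^esub> a) s = s" using s a by (simp add: invariant_functions_def)
    then show ?thesis using that a by (auto simp: Orb_def act_fun_translate)
  qed
  ultimately have "bij_betw (act_fun a) (Orb s) (Orb s)"
    using a Orb_subset[of s] by (intro bij_betw_byWitness[where f' = "act_fun (inv\<^bsub>A\<^esub> a)"]) (auto simp: subset_iff)
  then have "(\<Sum>T\<in>Orb s. lam T (act_fun a f)) = (\<Sum>T\<in>Orb s. lam (act_fun a T) (act_fun a f))"
    by (rule sum.reindex_bij_betw[symmetric])
  then have "(\<Sum>T\<in>Orb s. lam T (act_fun a f)) = (\<Sum>T\<in>Orb s. lam T f)"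
    using a by (simp add: lam_act_fun)
  then show ?thesis using g a stab by (simp add: BV_action_apply chi_apply)
qed

text \<open>Given an invariant \<open>chi s \<mu>\<close>, first \<open>s\<close> is replaced by an
  invariant translate, which does not change the character; only then can \<open>\<mu>\<close> be
  replaced by the trivial character.\<close>

theorem Irr_inv_BV:
  "Irr_inv A (BV_action A V \<phi>) (BV V) = (\<lambda>s. chi s one_character) ` invariant_functions"
proof
  show "(\<lambda>s. chi s one_character) ` invariant_functions \<subseteq> Irr_inv A (BV_action A V \<phi>) (BV V)"
    unfolding Irr_inv_def using chi_one_invariant
    by (auto simp: invariant_functions_def intro!: chi_in_Irr)
next
  show "Irr_inv A (BV_action A V \<phi>) (BV V) \<subseteq> (\<lambda>s. chi s one_character) ` invariant_functions"
  proof
    fix \<chi> assume chi: "\<chi> \<in> Irr_inv A (BV_action A V \<phi>) (BV V)"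
    then obtain s \<mu> where s: "s \<in> F2_functions V" and mu: "sign_character \<mu>" and eq: "\<chi> = chi s \<mu>"
      by (auto simp: Irr_inv_def Irr_BV)
    have inv: "chi s \<mu> (BV_action A V \<phi> a g) = chi s \<mu> g" if "a \<in> carrier A" "g \<in> carrier (BV V)" for a g
      using chi that unfolding Irr_inv_def eq by blast
    obtain t where t: "t \<in> carrier V" "translate V t s \<in> invariant_functions"
      using invariant_translate_exists[OF s] act_fun_in_Orb[OF s mu _ inv] by blast
    have "chi (translate V t s) \<mu> = chi (translate V t s) one_character"
      using t(2) mu by (rule chi_invariant_eq_chi_one) (use inv in \<open>simp add: chi_translate s t(1)\<close>)
    then show "\<chi> \<in> (\<lambda>s. chi s one_character) ` invariant_functions"
      using t(2) eq chi_translate[OF s t(1), of \<mu>] by auto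
  qed
qed

text \<open>Equal characters have equal weights, so the two functions share an orbit, which contains
  only one invariant function.\<close>

lemma inj_on_chi_one: "inj_on (\<lambda>s. chi s one_character) invariant_functions"
proof (rule inj_onI)
  fix s s' assume s: "s \<in> invariant_functions" "s' \<in> invariant_functions"
    and eq: "chi s one_character = chi s' one_character"
  then have F: "s \<in> F2_functions V" "s' \<in> F2_functions V" by (simp_all add: invariant_functions_def)
  have "s \<in> Orb s'"
    using chi_weight[OF F(1) F(1) sign_character_one] chi_weight[OF F sign_character_one] Orb_self[OF F(1)]
    by (auto simp: eq card_F2_functions split: if_splits)
  then obtain t where "t \<in> carrier V" "s = translate V t s'" by (auto simp: Orb_def)
  then show "s = s'" using invariant_functions_orbit_unique[of s' t] s by simp
qed

lemma card_Irr_inv_BV: "card (Irr_inv A (BV_action A V \<phi>) (BV V)) = card invariant_functions"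
  by (simp add: Irr_inv_BV card_image inj_on_chi_one)

section \<open>An invariant character that vanishes at a fixed element\<close>

lemma fdelta_zero_invariant: "fdelta \<zero>\<^bsub>V\<^esub> \<in> invariant_functions"
proof -
  have "\<phi> (inv\<^bsub>A\<^esub> a) x = \<zero>\<^bsub>V\<^esub> \<longleftrightarrow> x = \<zero>\<^bsub>V\<^esub>" if "a \<in> carrier A" "x \<in> carrier V" for a x
  proof
    assume "\<phi> (inv\<^bsub>A\<^esub> a) x = \<zero>\<^bsub>V\<^esub>"
    then have "\<phi> a (\<phi> (inv\<^bsub>A\<^esub> a) x) = \<zero>\<^bsub>V\<^esub>" using that by (simp only: act_zero)
    then show "x = \<zero>\<^bsub>V\<^esub>" using that by simp
  qed (use that in simp)
  then have "act_fun a (fdelta \<zero>\<^bsub>V\<^esub>) = fdelta \<zero>\<^bsub>V\<^esub>" if "a \<in> carrier A" for a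
    using that by (intro F2_functions_eqI) (simp_all add: act_fun_apply, simp add: fdelta_def)
  then show ?thesis by (simp add: invariant_functions_def)
qed

text \<open>The orbit of the point mass at zero consists of all point masses, one for each vector,
  and \<open>lam\<close> pairs \<open>f\<close> with such a mass by evaluation.\<close>

lemma chi_fdelta_zero:
  assumes f: "f \<in> F2_functions V"
  shows "chi (fdelta \<zero>\<^bsub>V\<^esub>) one_character (f, \<zero>\<^bsub>V\<^esub>) = (\<Sum>x\<in>carrier V. bit_sign (f x))"
proof -
  have tr: "translate V t (fdelta \<zero>\<^bsub>V\<^esub>) = fdelta t" if t: "t \<in> carrier V" for t
  proof (rule F2_functions_eqI)
    fix x assume x: "x \<in> carrier V"
    have "x \<oplus>\<^bsub>V\<^esub> t = \<zero>\<^bsub>V\<^esub> \<longleftrightarrow> x = t"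
      using add_add_self[OF x t] t by auto
    then show "translate V t (fdelta \<zero>\<^bsub>V\<^esub>) x = fdelta t x" using x t by (simp add: fdelta_def)
  qed simp_all
  have "Orb (fdelta \<zero>\<^bsub>V\<^esub>) = fdelta ` carrier V"
    by (simp add: Orb_def tr cong: image_cong)
  moreover have "inj_on fdelta (carrier V)"
  proof (rule inj_onI)
    fix x y assume xy: "x \<in> carrier V" "y \<in> carrier V" and "fdelta x = fdelta y"
    then have "fdelta x x = fdelta y x" by simp
    then show "x = y" using xy by (simp add: fdelta_def split: if_splits)
  qed
  ultimately have "(\<Sum>T\<in>Orb (fdelta \<zero>\<^bsub>V\<^esub>). lam T f) = (\<Sum>x\<in>carrier V. lam (fdelta x) f)"
    by (simp add: sum.reindex)
  also have "\<dots> = (\<Sum>x\<in>carrier V. bit_sign (f x))"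
    by (intro sum.cong) (simp_all add: lam_commute[of _ f] lam_fdelta)
  finally show ?thesis using f by (simp add: chi_apply)
qed

lemma card_N_inv_BV_less:
  assumes S: "S \<subseteq> carrier V" "\<forall>a\<in>carrier A. \<phi> a ` S \<subseteq> S" "2 * card S = card (carrier V)"
  shows "card (N_inv A (BV_action A V \<phi>) (BV V)) < card (Irr_inv A (BV_action A V \<phi>) (BV V))"
proof (rule psubset_card_mono)
  show "finite (Irr_inv A (BV_action A V \<phi>) (BV V))"
    by (simp add: Irr_inv_BV finite_invariant_functions)
  let ?f = "\<lambda>x\<in>carrier V. if x \<in> S then 1 else 0 :: bit"
  \<comment> \<open>Stability is given as inclusion only; applying it to both \<open>a\<close> and
    its inverse yields the equivalence.\<close>
  have "\<phi> (inv\<^bsub>A\<^esub> a) x \<in> S \<longleftrightarrow> x \<in> S" if "a \<in> carrier A" "x \<in> carrier V" for a x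
    using S(2) that by (metis A.inv_closed act_inv(2) image_subset_iff)
  moreover have fF: "?f \<in> F2_functions V" by (simp add: F2_functions_eq)
  ultimately have "act_fun a ?f = ?f" if "a \<in> carrier A" for a
    using that by (intro F2_functions_eqI) (simp_all add: act_fun_apply)
  with fF have f: "?f \<in> invariant_functions" by (simp add: invariant_functions_def)
  have "(\<Sum>x\<in>carrier V. bit_sign (?f x)) = (\<Sum>x\<in>carrier V. 1 - 2 * (if x \<in> S then 1 else 0))"
    by (intro sum.cong) auto
  also have "\<dots> = of_nat (card (carrier V)) - 2 * of_nat (card S)"
    using S(1) finite_carrier
    by (simp add: sum_subtractf Int_absorb1 flip: sum_distrib_left sum.inter_restrict)
  also have "\<dots> = 0" by (simp flip: S(3))
  finally have "chi (fdelta \<zero>\<^bsub>V\<^esub>) one_character (?f, \<zero>\<^bsub>V\<^esub>) = 0"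
    using f by (simp add: chi_fdelta_zero invariant_functions_def)
  moreover have "(?f, \<zero>\<^bsub>V\<^esub>) \<in> carrier (fixed_subgroup A (BV_action A V \<phi>) (BV V))"
    using f by (simp add: carrier_fixed_subgroup)
  ultimately have "chi (fdelta \<zero>\<^bsub>V\<^esub>) one_character \<notin> N_inv A (BV_action A V \<phi>) (BV V)"
    unfolding N_inv_def by blast
  moreover have "chi (fdelta \<zero>\<^bsub>V\<^esub>) one_character \<in> Irr_inv A (BV_action A V \<phi>) (BV V)"
    using fdelta_zero_invariant by (simp add: Irr_inv_BV)
  ultimately show "N_inv A (BV_action A V \<phi>) (BV V) \<subset> Irr_inv A (BV_action A V \<phi>) (BV V)"
    unfolding N_inv_def by blast
qed

end

text \<open>The order of \<open>BV V\<close> is an increasing function of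
  \<open>card (carrier V)\<close>, so the groups are told apart by their orders.\<close>

lemma card_BV_strict_mono:
  assumes "finite_F2_space V" "finite_F2_space W" "card (carrier V) < card (carrier W)"
  shows "card (carrier (BV V)) < card (carrier (BV W))"
proof -
  interpret V: finite_F2_space V by fact
  interpret W: finite_F2_space W by fact
  show ?thesis unfolding V.card_BV W.card_BV
    using assms(3) by (intro mult_strict_mono) simp_all
qed

text \<open>Infinitely many groups are given as a sequence of pairwise nonisomorphic ones, with
  modules on \<open>nat\<close> whatever the type of the initial module.\<close>

theorem proposition2p12:
  fixes A :: "('a, 'm) monoid_scheme"
  assumes "group A" and "finite (carrier A)" and "odd (Coset.order A)"
  shows
    "(\<forall>(V :: (bit, 'v) module) \<phi> (V' :: (bit, 'w) module) \<phi>'.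
        balanced A V \<phi> \<longrightarrow> finite_F2_module A V' \<phi>' \<longrightarrow> no_fixed_vector A V' \<phi>' \<longrightarrow>
        balanced A (direct_sum V V') (direct_sum_action V V' \<phi> \<phi>'))
     \<and>
     ((\<exists>(V :: (bit, 'v) module) \<phi>. balanced A V \<phi>) \<longrightarrow>
        (\<forall>N. \<exists>(V :: (bit, nat) module) \<phi>. balanced A V \<phi> \<and> N \<le> vectorspace.dim F2 V)
        \<and>
        (\<exists>(V :: nat \<Rightarrow> (bit, nat) module) \<phi>.
           (\<forall>k l. k \<noteq> l \<longrightarrow> \<not> BV (V k) \<cong> BV (V l)) \<and>
           (\<forall>k. balanced A (V k) (\<phi> k) \<and>
                (let G = BV (V k);
                     \<psi> = BV_action A (V k) (\<phi> k);
                     C = fixed_subgroup A \<psi> G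
                 in elementary_abelian C \<and>
                    card (Irr_inv A \<psi> G) = Coset.order (abelianization C) \<and>
                    card (N_inv A \<psi> G) < Coset.order (abelianization C)))))"
proof (intro conjI impI allI)
  fix V :: "(bit, 'v) module" and V' :: "(bit, 'w) module" and \<phi> \<phi>'
  assume "balanced A V \<phi>" "finite_F2_module A V' \<phi>'" "no_fixed_vector A V' \<phi>'"
  then show "balanced A (direct_sum V V') (direct_sum_action V V' \<phi> \<phi>')"
    by (rule balanced_direct_sum)
next
  assume "\<exists>(V :: (bit, 'v) module) \<phi>. balanced A V \<phi>"
  then obtain W :: "nat \<Rightarrow> (bit, nat) module" and \<psi>
    where W: "\<And>k. balanced A (W k) (\<psi> k)" "strict_mono (\<lambda>k. card (carrier (W k)))"
    by (metis balanced_sequence)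
  have space: "finite_F2_space (W k)" for k
    using W(1)[of k] by (simp add: balanced_def finite_F2_module_def finite_F2_space_def finite_F2_space_axioms_def)
  show "\<exists>(V :: (bit, nat) module) \<phi>. balanced A V \<phi> \<and> N \<le> vectorspace.dim F2 V" for N
  proof (intro exI conjI)
    \<comment> \<open>The index is \<open>2 ^ N\<close> because a strictly increasing sequence is at
      least its index: the size is then at least \<open>2 ^ N\<close>, and the dimension at least
      \<open>N\<close>.\<close>
    show "balanced A (W (2 ^ N)) (\<psi> (2 ^ N))" by (rule W(1))
    have "2 ^ N \<le> card (carrier (W (2 ^ N)))"
      by (rule strict_mono_imp_increasing[OF W(2)])
    also have "\<dots> \<le> 2 ^ vectorspace.dim F2 (W (2 ^ N))"
      using space[of "2 ^ N"]
      by (intro card_le_two_power_dim) (simp_all add: finite_F2_space_def finite_F2_space_axioms_def)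
    finally show "N \<le> vectorspace.dim F2 (W (2 ^ N))" by simp
  qed
  show "\<exists>(V :: nat \<Rightarrow> (bit, nat) module) \<phi>.
           (\<forall>k l. k \<noteq> l \<longrightarrow> \<not> BV (V k) \<cong> BV (V l)) \<and>
           (\<forall>k. balanced A (V k) (\<phi> k) \<and>
                (let G = BV (V k);
                     \<psi> = BV_action A (V k) (\<phi> k);
                     C = fixed_subgroup A \<psi> G
                 in elementary_abelian C \<and>
                    card (Irr_inv A \<psi> G) = Coset.order (abelianization C) \<and>
                    card (N_inv A \<psi> G) < Coset.order (abelianization C)))"
    unfolding Let_def
  proof (intro exI[of _ W] exI[of _ \<psi>] conjI allI impI)
    fix k l :: nat assume "k \<noteq> l"
    moreover have "card (carrier (BV (W k))) < card (carrier (BV (W l)))" if "k < l" for k l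
      using card_BV_strict_mono[OF space space] strict_monoD[OF W(2) that] .
    ultimately have "card (carrier (BV (W k))) \<noteq> card (carrier (BV (W l)))"
      by (metis linorder_neqE_nat less_irrefl)
    then show "\<not> BV (W k) \<cong> BV (W l)" using iso_same_card by blast
  next
    fix k
    show "balanced A (W k) (\<psi> k)" by (rule W(1))
    interpret odd_F2_module A "W k" "\<psi> k"
      using W(1)[of k] assms by (simp add: odd_F2_module_def odd_F2_module_axioms_def balanced_def)
    obtain S where S: "S \<subseteq> carrier (W k)" "\<forall>a\<in>carrier A. \<psi> k a ` S \<subseteq> S" "2 * card S = card (carrier (W k))"
      using W(1)[of k] by (auto simp: balanced_def)
    show "elementary_abelian (fixed_subgroup A (BV_action A (W k) (\<psi> k)) (BV (W k)))"
      by (rule elementary_abelian_fixed_subgroup)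
    show eq: "card (Irr_inv A (BV_action A (W k) (\<psi> k)) (BV (W k))) =
        Coset.order (abelianization (fixed_subgroup A (BV_action A (W k) (\<psi> k)) (BV (W k))))"
      by (simp add: card_Irr_inv_BV order_abelianization_fixed_subgroup)
    show "card (N_inv A (BV_action A (W k) (\<psi> k)) (BV (W k))) <
        Coset.order (abelianization (fixed_subgroup A (BV_action A (W k) (\<psi> k)) (BV (W k))))"
      using card_N_inv_BV_less[OF S] by (simp add: eq)
  qed
qed

end
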